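(* Let $\xi=(\mathbf{X},\mathcal{S}_\mu^{\mathbb{Z}_+},\mu)$ be a stationary discrete-time random process with state space $(\mathbf{S},\mathcal{S})$, let $A\colon\mathbf{S}\to\mathbb{R}^{d\times d}$ be a bounded measurable matrix-valued function, and let $A_\xi$ be the linear random system generated by $A$ and $\xi$. Given any linear subspace $\mathbb{L}\subseteq\mathbb{R}^d$, $A_\xi$ is $\mathbb{L}$-conditionally Lyapunov stable if and only if $A_\xi$ is $\mathbb{L}$-conditionally exponentially stable.
   Context: $\mathbb{Z}_+$ is the set of nonnegative integers, $1\le d<\infty$; $\mathbb{R}^d$ carries a fixed vector norm $\|\cdot\|$ and $\mathbb{R}^{d\times d}$ the induced operator norm $\|\cdot\|$. For a matrix $M$ and a linear subspace $L\subseteq\mathbb{R}^d$, $\|M|L\|$ is the operator norm of the restriction of $u\mapsto Mu$ to $L$; $\log 0=-\infty$. Random process: $(\mathbf{S},\mathcal{S})$ is a measurable space, $\mathbf{X}=\mathbf{S}^{\mathbb{Z}_+}$ is the set of sequences $x_{\cdot}=(x_0,x_1,x_2,\dots)$ in $\mathbf{S}$, $\mathcal{S}^{\mathbb{Z}_+}$ is the $\sigma$-algebra generated by the cylindrical sets $\{x_{\cdot}\in\mathbf{X} : x_{i_1}\in C_1,\dots,x_{i_r}\in C_r\}$ with $1\le r<\infty$, integers $0\le i_1<\dots<i_r$ and $C_1,\dots,C_r\in\mathcal{S}$; $\mu$ is a probability measure on $\mathcal{S}^{\mathbb{Z}_+}$, and $\mathcal{S}_\mu^{\mathbb{Z}_+}$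 is the completion of $\mathcal{S}^{\mathbb{Z}_+}$ with respect to $\mu$. The process is stationary if for every such choice the value $\mu(\{x_{\cdot}: x_{i_1+n}\in C_1,\dots,x_{i_r+n}\in C_r\})$ does not depend on $n\ge0$ (equivalently, the shift $x_{\cdot}\mapsto x_{\cdot+1}$ preserves $\mu$). Linear random system: bounded means $\|A(s)\|\le\beta$ for all $s\in\mathbf{S}$, for some constant $\beta$. $A_\xi\colon\mathbb{Z}_+\times\mathbf{X}\to\mathbb{R}^{d\times d}$ is defined by $A_\xi(0,x_{\cdot})=\mathrm{I}_{d\times d}$ and $A_\xi(n,x_{\cdot})=A(x_{n-1})\cdots A(x_0)$ for $n\ge1$. Stability: $A_\xi$ is $\mathbb{L}$-conditionally Lyapunov stable if $\mu\big(\{x_{\cdot}\in\mathbf{X} : \lim_{n\to\infty}\|A_\xi(n,x_{\cdot})|\mathbb{L}\|=0\}\big)>0$. $A_\xi$ is $\mathbb{L}$-conditionally exponentially stable if $\mu\big(\{x_{\cdot}\in\mathbf{X} : \lim_{n\to\infty}n^{-1}\log\|A_\xi(n,x_{\cdot})|\mathbb{L}\|<0\}\big)>0$ (limit value $-\infty$ allowed). *)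

theory Defs
  imports "HOL-Probability.Probability"
begin

(* The axioms of class real_normed_vector, for a norm other than the Euclidean one
   attached to the type. Nonnegativity follows. *)
definition vector_norm :: "('a::real_vector \<Rightarrow> real) \<Rightarrow> bool" where
  "vector_norm N \<longleftrightarrow>
     (\<forall>x. N x = 0 \<longleftrightarrow> x = 0) \<and>
     (\<forall>x y. N (x + y) \<le> N x + N y) \<and>
     (\<forall>c x. N (c *\<^sub>R x) = \<bar>c\<bar> * N x)"

(* Operator norm, with respect to N on both sides, of u \<mapsto> M u restricted to L. As for onorm,
   u = 0 contributes 0 / 0 = 0, so the value for L = {0} is 0. *)
definition restr_onorm :: "(real ^ 'd \<Rightarrow> real) \<Rightarrow> real ^ 'd ^ 'd \<Rightarrow> (real ^ 'd) set \<Rightarrow> real" where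
  "restr_onorm N M L = (SUP u\<in>L. N (M *v u) / N u)"

lemma restr_onorm_norm_UNIV: "restr_onorm norm M UNIV = onorm ((*v) M)"
  by (simp add: restr_onorm_def onorm_def)

definition bounded_matrix_fun ::
    "(real ^ 'd \<Rightarrow> real) \<Rightarrow> 's measure \<Rightarrow> ('s \<Rightarrow> real ^ 'd ^ 'd) \<Rightarrow> bool" where
  "bounded_matrix_fun N S A \<longleftrightarrow> (\<exists>\<beta>. \<forall>s\<in>space S. restr_onorm N (A s) UNIV \<le> \<beta>)"

(* S is used only as a measurable space, its measure is irrelevant. *)
definition random_process :: "'s measure \<Rightarrow> (nat \<Rightarrow> 's) measure \<Rightarrow> bool" where
  "random_process S \<mu> \<longleftrightarrow> prob_space \<mu> \<and> sets \<mu> = sets (\<Pi>\<^sub>M i\<in>UNIV. S)"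

(* The finite set I plays the role of the time indices i_1 < ... < i_r, r \<ge> 1. *)
definition stationary :: "'s measure \<Rightarrow> (nat \<Rightarrow> 's) measure \<Rightarrow> bool" where
  "stationary S \<mu> \<longleftrightarrow>
     (\<forall>I C. finite I \<longrightarrow> I \<noteq> {} \<longrightarrow> (\<forall>i\<in>I. C i \<in> sets S) \<longrightarrow>
       (\<forall>n. measure \<mu> {x \<in> space \<mu>. \<forall>i\<in>I. x (i + n) \<in> C i} =
            measure \<mu> {x \<in> space \<mu>. \<forall>i\<in>I. x i \<in> C i}))"

primrec linear_system :: "('s \<Rightarrow> real ^ 'd ^ 'd) \<Rightarrow> nat \<Rightarrow> (nat \<Rightarrow> 's) \<Rightarrow> real ^ 'd ^ 'd" where
  "linear_system A 0 x = mat 1"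
| "linear_system A (Suc n) x = A (x n) ** linear_system A n x"

(* Logarithm of a nonnegative real with log 0 = -\<infinity>; HOL's ln has ln 0 = 0. *)
definition log_ext :: "real \<Rightarrow> ereal" where
  "log_ext r = (if r = 0 then -\<infinity> else ereal (ln r))"

definition conditionally_Lyapunov_stable ::
    "(real ^ 'd \<Rightarrow> real) \<Rightarrow> (nat \<Rightarrow> 's) measure \<Rightarrow> ('s \<Rightarrow> real ^ 'd ^ 'd) \<Rightarrow> (real ^ 'd) set \<Rightarrow> bool" where
  "conditionally_Lyapunov_stable N \<mu> A L \<longleftrightarrow>
     measure (completion \<mu>)
       {x \<in> space \<mu>. (\<lambda>n. restr_onorm N (linear_system A n x) L) \<longlonglongrightarrow> 0} > 0"

(* The limit must exist in the extended reals; the value -\<infinity> is allowed. *)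
definition conditionally_exponentially_stable ::
    "(real ^ 'd \<Rightarrow> real) \<Rightarrow> (nat \<Rightarrow> 's) measure \<Rightarrow> ('s \<Rightarrow> real ^ 'd ^ 'd) \<Rightarrow> (real ^ 'd) set \<Rightarrow> bool" where
  "conditionally_exponentially_stable N \<mu> A L \<longleftrightarrow>
     measure (completion \<mu>)
       {x \<in> space \<mu>. \<exists>l<0.
          (\<lambda>n. ereal (1 / real n) * log_ext (restr_onorm N (linear_system A n x) L)) \<longlonglongrightarrow> l} > 0"

end

theory Submission
  imports Defs
begin

text \<open>Exponential stability implies Lyapunov stability path by path, so the set of exponentially stable
paths lies in the set of Lyapunov stable ones. The content is the converse: on almost all of a set
of positive measure on which the restricted norms tend to \<open>0\<close>, the exponential growth rate must be
shown to exist as a limit, and to be negative. Write \<open>\<Phi> n x\<close> for the product of the first \<open>n\<close>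
matrices along the path \<open>x\<close>, a linear cocycle over the shift \<open>T\<close>. Subspaces depending on \<open>x\<close> are called
fields; an invariant field is one that \<open>\<Phi> 1 x\<close> maps from \<open>x\<close> to \<open>T x\<close>.

\<^bold>\<open>Existence of the rate.\<close> It suffices that for each rational \<open>s\<close> almost surely either some vector of the
subspace grows at least like \<open>exp (s n)\<close>, or the whole subspace grows at most like \<open>exp ((s + \<epsilon>) n)\<close>
for all \<open>\<epsilon> > 0\<close> (\<open>AE_growth_dichotomy\<close>): no rational number then separates the lower from the upper rate.
Call a functional \<open>g\<close> dominated on a subspace \<open>V\<close> if \<open>\<bar>g w\<bar> \<le> C exp (- s n) \<parallel>\<Phi> n x w\<parallel>\<close> for all \<open>w\<close> in \<open>V\<close> and all
\<open>n\<close>. A vector not annihilated by such a functional grows at least like \<open>exp (s n)\<close>. Passing repeatedly to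
the common kernel of the dominated functionals ends, after as many steps as the dimension, in an
invariant field \<open>W\<close> on which only the zero functional is dominated. Now compare the normalized norm
\<open>exp (- s m) \<parallel>\<Phi> m x restricted to W x\<parallel>\<close> with the normalized norms obtained by starting later on the orbit
and ending at the same time, and call \<open>m\<close> good at \<open>x\<close> if the former is positive and at
least as large as all of the latter. Functionals built from
nearly extremal vectors at good times \<open>m\<close> satisfy the domination inequality up to time \<open>m\<close>, so infinitely
many good times would yield a nonzero dominated functional in the limit
(\<open>good_times_yield_functional\<close>). Hence every \<open>x\<close> has only finitely many good times, and by the maximal
ergodic inequality the orbit rarely visits points with a late good time. But the normalized norm can be
large only if there are many such visits (\<open>growth_le_good_visits\<close>), since a time that is not good is
overtaken by a later starting point. So \<open>W\<close> grows with rate at most \<open>s\<close>.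

\<^bold>\<open>Negativity of the rate.\<close> By Egorov's argument the norms tend to \<open>0\<close> at a uniform speed on a smaller set of
positive measure. The vectors decaying at least at that speed form an invariant field on which the norm
tends to \<open>0\<close> at every point. Almost every orbit has a \<open>k\<close> such that it spends at least half of the
time in the set where the norm is at most \<open>1 / 2\<close> from time \<open>k\<close> on, and visits to that set at distance \<open>k\<close> or more halve the norm
(\<open>AE_exponential_decay\<close>).

Fields only enter through the norms of the cocycle on them, whose measurability is needed for the
ergodic inequality. All fields in use are countable unions of closed sets cut out by countably many
inequalities, or orthogonal complements of such, and compactness makes their orthogonal projections
measurable (\<open>measurable_field_of_inequalities\<close>).\<close>

section \<open>Frequency of visits under a measure-preserving map\<close>

definition visits :: "('x \<Rightarrow> 'x) \<Rightarrow> 'x set \<Rightarrow> nat \<Rightarrow> 'x \<Rightarrow> real" where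
  "visits T B n x = (\<Sum>j<n. indicat_real B ((T ^^ j) x))"

lemma visits_0 [simp]: "visits T B 0 x = 0"
  by (simp add: visits_def)

lemma visits_1 [simp]: "visits T B (Suc 0) x = indicat_real B x"
  by (simp add: visits_def)

lemma visits_nonneg: "0 \<le> visits T B n x"
  by (simp add: visits_def sum_nonneg)

lemma visits_le: "visits T B n x \<le> real n"
proof -
  have "visits T B n x \<le> (\<Sum>j<n. 1)"
    unfolding visits_def by (rule sum_mono) (simp add: indicator_def)
  then show ?thesis by simp
qed

lemma visits_add: "visits T B (m + n) x = visits T B m x + visits T B n ((T ^^ m) x)"
proof (induction n)
  case (Suc n)
  have "(T ^^ (m + n)) x = (T ^^ n) ((T ^^ m) x)"
    by (metis add.commute comp_apply funpow_add)
  with Suc show ?case by (simp add: visits_def)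
qed simp

lemma visits_Compl: "visits T (- B) n x = real n - visits T B n x"
proof -
  have "visits T (- B) n x = (\<Sum>j<n. 1 - indicat_real B ((T ^^ j) x))"
    unfolding visits_def by (rule sum.cong) (simp_all add: indicator_def)
  then show ?thesis by (simp add: visits_def sum_subtractf)
qed

text \<open>The greedy covering argument behind the maximal inequality: starting from a point of \<open>Q\<close>, an orbit
segment of length at most \<open>N\<close> can be cut off in which \<open>B\<close> has frequency at least \<open>\<epsilon>\<close>; points outside \<open>Q\<close> are
skipped. The error term pays for a segment that overshoots \<open>K\<close>.\<close>

lemma visits_covering:
  assumes "0 \<le> \<epsilon>"
    and "Q = {y. \<exists>n. 1 \<le> n \<and> n \<le> N \<and> \<epsilon> * real n \<le> visits T B n y}"
  shows "\<epsilon> * visits T Q K x \<le> visits T B K x + \<epsilon> * real N"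
proof (induction K arbitrary: x rule: less_induct)
  case (less K)
  consider "K = 0" | "K > 0" "x \<notin> Q" | n where "1 \<le> n" "n \<le> N" "\<epsilon> * real n \<le> visits T B n x"
    using assms(2) by fastforce
  then show ?case
  proof cases
    case 1
    then show ?thesis using assms(1) by simp
  next
    case 2
    have split: "visits T Z K x = indicat_real Z x + visits T Z (K - 1) (T x)" for Z
      using visits_add[of T Z 1 "K - 1" x] \<open>K > 0\<close> by simp
    have "\<epsilon> * visits T Q (K - 1) (T x) \<le> visits T B (K - 1) (T x) + \<epsilon> * real N"
      using less \<open>K > 0\<close> by simp
    then show ?thesis using 2 by (simp add: split indicator_def)
  next
    case (3 n)
    show ?thesis
    proof (cases "n \<le> K")
      case True
      have split: "visits T Z K x = visits T Z n x + visits T Z (K - n) ((T ^^ n) x)" for Z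
        using visits_add[of T Z n "K - n" x] True by simp
      have "\<epsilon> * visits T Q (K - n) ((T ^^ n) x) \<le> visits T B (K - n) ((T ^^ n) x) + \<epsilon> * real N"
        using less \<open>1 \<le> n\<close> True by simp
      moreover have "\<epsilon> * visits T Q n x \<le> \<epsilon> * real n"
        by (intro mult_left_mono visits_le assms(1))
      ultimately show ?thesis using 3 by (simp add: split distrib_left)
    next
      case False
      have "\<epsilon> * visits T Q K x \<le> \<epsilon> * real N"
        using visits_le[of T Q K x] False \<open>n \<le> N\<close> by (intro mult_left_mono assms(1)) linarith
      then show ?thesis using visits_nonneg[of T B K x] by linarith
    qed
  qed
qed

locale measure_preserving_system = prob_space M for M :: "'x measure" +
  fixes T :: "'x \<Rightarrow> 'x"
  assumes T_measurable: "T \<in> measurable M M"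
    and T_distr: "distr M M T = M"
begin

lemma iter_measurable [measurable]: "T ^^ n \<in> measurable M M"
  using T_measurable by (rule measurable_compose_n)

lemma iter_in_space: "x \<in> space M \<Longrightarrow> (T ^^ n) x \<in> space M"
  using measurable_space[OF iter_measurable] by blast

lemma iter_distr: "distr M M (T ^^ n) = M"
proof (induction n)
  case 0
  then show ?case by (simp add: distr_id id_def)
next
  case (Suc n)
  then show ?case
    using distr_distr[OF T_measurable iter_measurable[of n]]
    by (simp only: funpow.simps(2) T_distr)
qed

lemma visits_measurable [measurable]:
  assumes [measurable]: "B \<in> sets M"
  shows "visits T B n \<in> borel_measurable M"
  unfolding visits_def[abs_def] by measurable

lemma expectation_visits:
  assumes B [measurable]: "B \<in> sets M"
  shows "integrable M (visits T B n)" and "expectation (visits T B n) = real n * prob B"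
proof -
  have int: "integrable M (\<lambda>x. indicat_real B ((T ^^ j) x))" for j
    by (rule integrable_const_bound[of _ 1]) (auto simp: indicator_def)
  have "expectation (\<lambda>x. indicat_real B ((T ^^ j) x)) = prob B" for j
  proof -
    have "expectation (\<lambda>x. indicat_real B ((T ^^ j) x)) = (LINT y|distr M M (T ^^ j). indicat_real B y)"
      by (rule integral_distr[symmetric]) simp_all
    then show ?thesis by (simp add: iter_distr)
  qed
  then show "expectation (visits T B n) = real n * prob B"
    unfolding visits_def[abs_def] using int by (subst Bochner_Integration.integral_sum) simp_all
  show "integrable M (visits T B n)"
    unfolding visits_def[abs_def] using int by simp
qed

text \<open>Integrating the covering inequality over an orbit of length \<open>K\<close> and dividing by \<open>K\<close> removes the error term.\<close>

lemma maximal_inequality: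
  assumes B [measurable]: "B \<in> sets M" and "0 < \<epsilon>"
  shows "prob {x \<in> space M. \<exists>n\<ge>1. \<epsilon> * real n \<le> visits T B n x} \<le> prob B / \<epsilon>"
proof -
  define Q where "Q N = {x. \<exists>n. 1 \<le> n \<and> n \<le> N \<and> \<epsilon> * real n \<le> visits T B n x}" for N
  define Q' where "Q' N = {x \<in> space M. \<exists>n. 1 \<le> n \<and> n \<le> N \<and> \<epsilon> * real n \<le> visits T B n x}" for N
  have Q'_sets [measurable]: "Q' N \<in> sets M" for N
    unfolding Q'_def by measurable
  have bound: "prob (Q' N) \<le> prob B / \<epsilon>" for N
  proof -
    have le: "\<epsilon> * (real K * prob (Q' N)) \<le> real K * prob B + \<epsilon> * real N" for K
    proof -
      have "\<epsilon> * visits T (Q' N) K x \<le> visits T B K x + \<epsilon> * real N" if "x \<in> space M" for x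
      proof -
        have "visits T (Q' N) K x \<le> visits T (Q N) K x"
          unfolding visits_def by (intro sum_mono) (auto simp: indicator_def Q_def Q'_def)
        then have "\<epsilon> * visits T (Q' N) K x \<le> \<epsilon> * visits T (Q N) K x"
          using \<open>0 < \<epsilon>\<close> by simp
        also have "\<dots> \<le> visits T B K x + \<epsilon> * real N"
          using visits_covering[OF _ Q_def] \<open>0 < \<epsilon>\<close> by simp
        finally show ?thesis .
      qed
      then have "expectation (\<lambda>x. \<epsilon> * visits T (Q' N) K x) \<le> expectation (\<lambda>x. visits T B K x + \<epsilon> * real N)"
        using expectation_visits(1)[OF Q'_sets] expectation_visits(1)[OF B]
        by (intro integral_mono) auto
      then show ?thesis
        using expectation_visits[OF Q'_sets] expectation_visits[OF B] by (simp add: prob_space)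
    qed
    have "\<epsilon> * prob (Q' N) \<le> prob B"
    proof (rule ccontr)
      assume "\<not> ?thesis"
      then obtain K where "\<epsilon> * real N < real K * (\<epsilon> * prob (Q' N) - prob B)"
        using reals_Archimedean3[of "\<epsilon> * prob (Q' N) - prob B"] by auto
      with le[of K] show False by (simp add: algebra_simps)
    qed
    then show ?thesis using \<open>0 < \<epsilon>\<close> by (simp add: field_simps)
  qed
  have "incseq Q'" unfolding incseq_def Q'_def by fastforce
  then have "(\<lambda>N. prob (Q' N)) \<longlonglongrightarrow> prob (\<Union>N. Q' N)"
    by (intro finite_Lim_measure_incseq) auto
  then have "prob (\<Union>N. Q' N) \<le> prob B / \<epsilon>"
    by (rule LIMSEQ_le_const2) (use bound in auto)
  moreover have "(\<Union>N. Q' N) = {x \<in> space M. \<exists>n\<ge>1. \<epsilon> * real n \<le> visits T B n x}"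
    unfolding Q'_def by auto
  ultimately show ?thesis by simp
qed

text \<open>By the maximal inequality, the points that ever visit \<open>D N\<close> with frequency at least \<open>\<epsilon>\<close> have measure at most
\<open>prob (D N) / \<epsilon>\<close>, which tends to \<open>0\<close>. The bound holds for all \<open>n \<ge> 1\<close> rather than only
eventually; in particular \<open>n = 1\<close> shows that the point itself lies outside \<open>D N\<close> if \<open>\<epsilon> \<le> 1\<close>.\<close>

lemma AE_visits_rare:
  assumes D [measurable]: "\<And>N. D N \<in> sets M" and "decseq D" and "(\<Inter>N. D N) = {}" and "0 < \<epsilon>"
  shows "AE x in M. \<exists>N. \<forall>n\<ge>1. visits T (D N) n x < \<epsilon> * real n"
proof -
  define R where "R N = {x \<in> space M. \<exists>n\<ge>1. \<epsilon> * real n \<le> visits T (D N) n x}" for N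
  have R_sets [measurable]: "R N \<in> sets M" for N
    unfolding R_def by measurable
  have "(\<lambda>N. prob (D N)) \<longlonglongrightarrow> prob (\<Inter>N. D N)"
    using assms by (intro finite_Lim_measure_decseq) auto
  then have "(\<lambda>N. prob (D N) / \<epsilon>) \<longlonglongrightarrow> 0"
    using \<open>(\<Inter>N. D N) = {}\<close> by (auto intro: tendsto_divide_zero)
  moreover have "prob (\<Inter>N. R N) \<le> prob (D N) / \<epsilon>" for N
  proof -
    have "prob (\<Inter>N. R N) \<le> prob (R N)" by (intro finite_measure_mono) auto
    also have "\<dots> \<le> prob (D N) / \<epsilon>"
      unfolding R_def using maximal_inequality[OF D \<open>0 < \<epsilon>\<close>] .
    finally show ?thesis .
  qed
  ultimately have "prob (\<Inter>N. R N) \<le> 0"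
    by (intro LIMSEQ_le_const) auto
  then have "prob (\<Inter>N. R N) = 0"
    using measure_nonneg[of M "\<Inter>N. R N"] by linarith
  then have "(\<Inter>N. R N) \<in> null_sets M"
    by (intro null_setsI) (auto simp: emeasure_eq_measure)
  then show ?thesis
    by (rule AE_I') (auto simp: R_def not_less)
qed

end

section \<open>Measurable fields of subspaces\<close>

definition orth_proj :: "'v::euclidean_space set \<Rightarrow> 'v \<Rightarrow> 'v" where
  "orth_proj W v = (THE y. y \<in> W \<and> (\<forall>w\<in>W. inner (v - y) w = 0))"

lemma orth_proj_unique:
  assumes "subspace W" "y \<in> W" "\<And>w. w \<in> W \<Longrightarrow> inner (v - y) w = 0"
  shows "orth_proj W v = y"
  unfolding orth_proj_def
proof (rule the_equality)
  fix z assume z: "z \<in> W \<and> (\<forall>w\<in>W. inner (v - z) w = 0)"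
  then have "z - y \<in> W" using assms by (simp add: subspace_diff)
  then have "inner (z - y) (z - y) = 0"
    using z assms(3)[of "z - y"] by (simp add: inner_diff_left)
  then show "z = y" by simp
qed (use assms in blast)

lemma
  fixes W :: "'v::euclidean_space set"
  assumes "subspace W"
  shows orth_proj_in: "orth_proj W v \<in> W"
    and orth_proj_orthogonal: "w \<in> W \<Longrightarrow> inner (v - orth_proj W v) w = 0"
proof -
  obtain y z where "y \<in> span W" "\<And>w. w \<in> span W \<Longrightarrow> orthogonal z w" "v = y + z"
    using orthogonal_subspace_decomp_exists[of W v] by metis
  moreover have "span W = W" using assms by (simp add: span_eq_iff)
  ultimately have y: "y \<in> W" "\<And>w. w \<in> W \<Longrightarrow> inner (v - y) w = 0"
    by (auto simp: orthogonal_def)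
  then have "orth_proj W v = y" by (intro orth_proj_unique assms)
  then show "orth_proj W v \<in> W" "w \<in> W \<Longrightarrow> inner (v - orth_proj W v) w = 0"
    using y by auto
qed

lemma orth_proj_id: "subspace W \<Longrightarrow> v \<in> W \<Longrightarrow> orth_proj W v = v"
  by (rule orth_proj_unique) simp_all

lemma linear_orth_proj: "subspace W \<Longrightarrow> linear (orth_proj W)"
proof (rule linearI)
  fix u v c assume W: "subspace W"
  show "orth_proj W (u + v) = orth_proj W u + orth_proj W v"
  proof (rule orth_proj_unique[OF W])
    fix w assume "w \<in> W"
    then show "inner (u + v - (orth_proj W u + orth_proj W v)) w = 0"
      using orth_proj_orthogonal[OF W, of w u] orth_proj_orthogonal[OF W, of w v]
      by (simp add: algebra_simps)
  qed (simp add: W orth_proj_in subspace_add)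
  show "orth_proj W (c *\<^sub>R v) = c *\<^sub>R orth_proj W v"
  proof (rule orth_proj_unique[OF W])
    fix w assume "w \<in> W"
    then show "inner (c *\<^sub>R v - c *\<^sub>R orth_proj W v) w = 0"
      using orth_proj_orthogonal[OF W, of w v] by (simp add: inner_diff_left)
  qed (simp add: W orth_proj_in subspace_scale)
qed

lemma inner_orth_proj_commute:
  assumes "subspace W"
  shows "inner u (orth_proj W v) = inner (orth_proj W u) v"
  using orth_proj_orthogonal[OF assms orth_proj_in[OF assms], of u v]
    orth_proj_orthogonal[OF assms orth_proj_in[OF assms], of v u]
  by (simp add: inner_diff_left inner_commute[of v] inner_commute[of "orth_proj W v"])

lemma orth_proj_pythagoras:
  assumes "subspace W"
  shows "(norm v)\<^sup>2 = (norm (orth_proj W v))\<^sup>2 + (norm (v - orth_proj W v))\<^sup>2"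
proof -
  have "inner (v - orth_proj W v) (orth_proj W v) = 0"
    by (simp add: assms orth_proj_in orth_proj_orthogonal)
  then show ?thesis
    by (simp add: power2_norm_eq_inner algebra_simps inner_commute)
qed

lemma norm_orth_proj_le:
  assumes "subspace W"
  shows "norm (orth_proj W v) \<le> norm v"
proof (rule power2_le_imp_le)
  show "(norm (orth_proj W v))\<^sup>2 \<le> (norm v)\<^sup>2"
    using orth_proj_pythagoras[OF assms, of v] zero_le_power2[of "norm (v - orth_proj W v)"] by linarith
qed simp

lemma orth_proj_closest:
  assumes "subspace W" "w \<in> W"
  shows "norm (v - orth_proj W v) \<le> norm (v - w)"
proof -
  have "orth_proj W (v - w) = orth_proj W v - w"
    using linear_diff[OF linear_orth_proj[OF assms(1)]] orth_proj_id[OF assms] by simp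
  then have "norm (v - orth_proj W v) = norm ((v - w) - orth_proj W (v - w))" by simp
  also have "\<dots> \<le> norm (v - w)"
  proof (rule power2_le_imp_le)
    show "(norm (v - w - orth_proj W (v - w)))\<^sup>2 \<le> (norm (v - w))\<^sup>2"
      using orth_proj_pythagoras[OF assms(1), of "v - w"] zero_le_power2[of "norm (orth_proj W (v - w))"]
      by linarith
  qed simp
  finally show ?thesis .
qed

definition orth_comp :: "'v::euclidean_space set \<Rightarrow> 'v set" where
  "orth_comp W = {v. \<forall>w\<in>W. inner v w = 0}"

lemma subspace_orth_comp: "subspace (orth_comp W)"
  by (auto simp: orth_comp_def subspace_def inner_add_left)

lemma orth_proj_orth_comp:
  assumes "subspace W"
  shows "orth_proj (orth_comp W) v = v - orth_proj W v"
  by (rule orth_proj_unique[OF subspace_orth_comp])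
     (auto simp: orth_comp_def assms orth_proj_orthogonal orth_proj_in inner_commute[of "orth_proj W v"])

definition measurable_field :: "'x measure \<Rightarrow> ('x \<Rightarrow> 'v::euclidean_space set) \<Rightarrow> bool" where
  "measurable_field M W \<longleftrightarrow>
     (\<forall>x. subspace (W x)) \<and> (\<forall>v. (\<lambda>x. orth_proj (W x) v) \<in> borel_measurable M)"

lemma measurable_fieldD:
  assumes "measurable_field M W"
  shows "subspace (W x)" "(\<lambda>x. orth_proj (W x) v) \<in> borel_measurable M"
  using assms by (auto simp: measurable_field_def)

lemma measurable_field_UNIV: "measurable_field M (\<lambda>x. UNIV :: 'v::euclidean_space set)"
proof -
  have "orth_proj UNIV v = v" for v :: 'v
    by (rule orth_proj_id) simp_all
  then show ?thesis by (simp add: measurable_field_def)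
qed

lemma measurable_field_orth_comp:
  assumes "measurable_field M W"
  shows "measurable_field M (\<lambda>x. orth_comp (W x))"
  using measurable_fieldD[OF assms]
  by (simp add: measurable_field_def subspace_orth_comp orth_proj_orth_comp borel_measurable_diff)

text \<open>The hypothesis says that the distance to \<open>W x\<close> is measurable; by Pythagoras so is the quadratic form of the
projection, and polarization recovers the projection.\<close>

lemma measurable_fieldI_hits_balls:
  fixes W :: "'x \<Rightarrow> 'v::euclidean_space set"
  assumes W: "\<And>x. subspace (W x)"
    and hit: "\<And>v r. {x \<in> space M. \<exists>w\<in>W x. norm (v - w) < r} \<in> sets M"
  shows "measurable_field M W"
proof -
  have [measurable]: "(\<lambda>x. norm (v - orth_proj (W x) v)) \<in> borel_measurable M" for v
  proof (subst borel_measurable_iff_less, intro allI)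
    fix r
    have "{x \<in> space M. norm (v - orth_proj (W x) v) < r} = {x \<in> space M. \<exists>w\<in>W x. norm (v - w) < r}"
      by (auto intro: le_less_trans[OF orth_proj_closest[OF W]] orth_proj_in[OF W])
    then show "{x \<in> space M. norm (v - orth_proj (W x) v) < r} \<in> sets M" using hit by simp
  qed
  define q where "q x v = (norm v)\<^sup>2 - (norm (v - orth_proj (W x) v))\<^sup>2" for x v
  have [measurable]: "(\<lambda>x. q x v) \<in> borel_measurable M" for v
    unfolding q_def by measurable
  have q: "q x v = inner (orth_proj (W x) v) v" for x v
  proof -
    have "q x v = inner (orth_proj (W x) v) (orth_proj (W x) v)"
      unfolding q_def using orth_proj_pythagoras[OF W, of v x]
      by (simp only: power2_norm_eq_inner)
    also have "\<dots> = inner (orth_proj (W x) (orth_proj (W x) v)) v"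
      by (rule inner_orth_proj_commute[OF W])
    also have "\<dots> = inner (orth_proj (W x) v) v"
      by (simp only: orth_proj_id[OF W orth_proj_in[OF W]])
    finally show ?thesis .
  qed
  have polar: "inner (orth_proj (W x) v) b = (q x (v + b) - q x (v - b)) / 4" for x v b
  proof -
    have "inner (orth_proj (W x) b) v = inner (orth_proj (W x) v) b"
      using inner_orth_proj_commute[OF W, of b x v] by (metis inner_commute)
    then show ?thesis
      by (simp add: q linear_add[OF linear_orth_proj[OF W]] linear_diff[OF linear_orth_proj[OF W]]
          inner_add_left inner_add_right inner_diff_left inner_diff_right)
  qed
  have "(\<lambda>x. orth_proj (W x) v) \<in> borel_measurable M" for v
  proof -
    have "(\<lambda>x. \<Sum>b\<in>Basis. ((q x (v + b) - q x (v - b)) / 4) *\<^sub>R b) \<in> borel_measurable M"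
      by measurable
    then show ?thesis
      by (simp only: polar[symmetric] euclidean_representation)
  qed
  then show ?thesis using W by (simp add: measurable_field_def)
qed

lemma dense_sequence_exists:
  "\<exists>q :: nat \<Rightarrow> 'a::second_countable_topology. \<forall>X. open X \<and> X \<noteq> {} \<longrightarrow> (\<exists>j. q j \<in> X)"
proof -
  obtain D :: "'a set" where D: "countable D" "\<forall>X. open X \<longrightarrow> X \<noteq> {} \<longrightarrow> (\<exists>d\<in>D. d \<in> X)"
    using countable_dense_exists by blast
  then have "D \<noteq> {}" by (metis UNIV_not_empty empty_iff open_UNIV)
  then have "range (from_nat_into D) = D" using D(1) by (rule range_from_nat_into)
  then show ?thesis
    using D(2) by (intro exI[of _ "from_nat_into D"]) (metis imageE)
qed

text \<open>Whether a closed set cut out by countably many continuous inequalities meets a closed ball can be tested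
on a dense sequence: by compactness it suffices to satisfy finitely many inequalities up to an arbitrarily
small error. The countable union over \<open>c\<close> allows for conditions with an unspecified constant.\<close>

lemma measurable_field_of_inequalities:
  fixes W :: "'x \<Rightarrow> 'v::euclidean_space set" and F :: "nat \<Rightarrow> nat \<Rightarrow> 'x \<Rightarrow> 'v \<Rightarrow> real"
  assumes W: "\<And>x. subspace (W x)"
    and W_eq: "\<And>x. x \<in> space M \<Longrightarrow> W x = (\<Union>c. {w. \<forall>i. F c i x w \<le> 0})"
    and meas [measurable]: "\<And>c i w. (\<lambda>x. F c i x w) \<in> borel_measurable M"
    and cont: "\<And>c i x. x \<in> space M \<Longrightarrow> continuous_on UNIV (F c i x)"
  shows "measurable_field M W"
proof (rule measurable_fieldI_hits_balls[OF W])
  fix v :: 'v and r :: real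
  obtain q :: "nat \<Rightarrow> 'v" where q: "\<And>X. open X \<Longrightarrow> X \<noteq> {} \<Longrightarrow> \<exists>j. q j \<in> X"
    using dense_sequence_exists by metis
  let ?\<delta> = "\<lambda>m::nat. 1 / (real m + 1)"
  \<comment> \<open>The radius \<open>r - 1 / (k + 1)\<close> turns the open ball into a union of closed balls.\<close>
  have eq: "{x \<in> space M. \<exists>w\<in>W x. norm (v - w) < r} =
    {x \<in> space M. \<exists>c. \<exists>k. \<forall>m. \<exists>j. norm (v - q j) < r - ?\<delta> k + ?\<delta> m \<and> (\<forall>i\<in>{..m}. F c i x (q j) < ?\<delta> m)}"
    (is "?A = ?B")
  proof (intro set_eqI iffI)
    fix x assume "x \<in> ?A"
    then obtain w where x: "x \<in> space M" and "w \<in> W x" and w1: "norm (v - w) < r"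
      by blast
    then obtain c where w2: "\<And>i. F c i x w \<le> 0" using W_eq[OF x] by blast
    obtain k where "1 / real (Suc k) < r - norm (v - w)"
      using w1 by (meson nat_approx_posE diff_gt_0_iff_gt)
    then have k: "?\<delta> k < r - norm (v - w)" by (simp only: of_nat_Suc add.commute)
    have "\<exists>j. norm (v - q j) < r - ?\<delta> k + ?\<delta> m \<and> (\<forall>i\<in>{..m}. F c i x (q j) < ?\<delta> m)" for m
    proof -
      have "0 < ?\<delta> m" by simp
      have "open ({w'. norm (v - w') < r - ?\<delta> k + ?\<delta> m} \<inter> (\<Inter>i\<in>{..m}. {w'. F c i x w' < ?\<delta> m}))" (is "open ?O")
        by (intro open_Int open_INT ballI open_Collect_less continuous_on_const
            continuous_intros cont[OF x]) simp_all
      moreover have "w \<in> ?O"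
      proof -
        have "norm (v - w) < r - ?\<delta> k + ?\<delta> m"
          using k \<open>0 < ?\<delta> m\<close> by linarith
        moreover have "F c i x w < ?\<delta> m" for i using w2[of i] \<open>0 < ?\<delta> m\<close> by linarith
        ultimately show ?thesis by simp
      qed
      ultimately obtain j where "q j \<in> ?O" using q by blast
      then show ?thesis by auto
    qed
    then show "x \<in> ?B" using x by blast
  next
    fix x assume "x \<in> ?B"
    then obtain c k where x: "x \<in> space M" and
      "\<forall>m. \<exists>w. norm (v - w) < r - ?\<delta> k + ?\<delta> m \<and> (\<forall>i\<in>{..m}. F c i x w < ?\<delta> m)"
      by blast
    then obtain w where w: "\<And>m. norm (v - w m) < r - ?\<delta> k + ?\<delta> m" "\<And>m i. i \<le> m \<Longrightarrow> F c i x (w m) < ?\<delta> m"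
      by (metis atMost_iff)
    have "w m \<in> cball v (r + 1)" for m
    proof -
      have "?\<delta> m \<le> 1" "0 < ?\<delta> k" by simp_all
      then have "norm (v - w m) \<le> r + 1" using w(1)[of m] by linarith
      then show ?thesis by (simp add: dist_norm)
    qed
    then obtain z \<sigma> where \<sigma>: "strict_mono \<sigma>" "(w \<circ> \<sigma>) \<longlonglongrightarrow> z"
      using compact_cball[of v "r + 1"] unfolding compact_def by metis
    have \<delta>0: "(\<lambda>m. ?\<delta> (\<sigma> m)) \<longlonglongrightarrow> 0"
      using LIMSEQ_subseq_LIMSEQ[OF LIMSEQ_inverse_real_of_nat \<sigma>(1)]
      by (simp add: comp_def inverse_eq_divide add.commute)
    have "norm (v - z) \<le> r - ?\<delta> k + 0"
    proof (rule LIMSEQ_le)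
      show "(\<lambda>m. norm (v - (w \<circ> \<sigma>) m)) \<longlonglongrightarrow> norm (v - z)" by (intro tendsto_intros \<sigma>)
      show "(\<lambda>m. r - ?\<delta> k + ?\<delta> (\<sigma> m)) \<longlonglongrightarrow> r - ?\<delta> k + 0" by (intro tendsto_intros \<delta>0)
      show "\<exists>N. \<forall>m\<ge>N. norm (v - (w \<circ> \<sigma>) m) \<le> r - ?\<delta> k + ?\<delta> (\<sigma> m)"
        using w(1) by (auto intro: less_imp_le)
    qed
    moreover have "0 < ?\<delta> k" by simp
    ultimately have "norm (v - z) < r" by linarith
    moreover have "F c i x z \<le> 0" for i
    proof (rule LIMSEQ_le)
      have "isCont (F c i x) z" using cont[OF x, of c i] by (simp add: continuous_on_eq_continuous_at)
      then show "(\<lambda>m. F c i x ((w \<circ> \<sigma>) m)) \<longlonglongrightarrow> F c i x z"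
        using \<sigma>(2) by (rule isCont_tendsto_compose)
      show "(\<lambda>m. ?\<delta> (\<sigma> m)) \<longlonglongrightarrow> 0" by (rule \<delta>0)
      have "F c i x ((w \<circ> \<sigma>) m) \<le> ?\<delta> (\<sigma> m)" if "i \<le> m" for m
        using w(2)[of i "\<sigma> m"] seq_suble[OF \<sigma>(1), of m] that by (simp add: less_imp_le)
      then show "\<exists>N. \<forall>m\<ge>N. F c i x ((w \<circ> \<sigma>) m) \<le> ?\<delta> (\<sigma> m)" by blast
    qed
    ultimately show "x \<in> ?A" using W_eq[OF x] x by blast
  qed
  show "{x \<in> space M. \<exists>w\<in>W x. norm (v - w) < r} \<in> sets M"
    unfolding eq by measurable
qed

section \<open>Linear cocycles\<close>

locale linear_cocycle = measure_preserving_system M T for M :: "'x measure" and T +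
  fixes \<Phi> :: "nat \<Rightarrow> 'x \<Rightarrow> 'v::euclidean_space \<Rightarrow> 'v" and \<beta> :: real
  assumes lin: "linear (\<Phi> n x)"
    and \<Phi>_0: "\<Phi> 0 x v = v"
    and \<Phi>_add: "\<Phi> (m + n) x v = \<Phi> n ((T ^^ m) x) (\<Phi> m x v)"
    and \<Phi>_measurable [measurable]: "(\<lambda>x. \<Phi> n x v) \<in> borel_measurable M"
    and \<beta>: "1 \<le> \<beta>"
    and \<Phi>_bound: "x \<in> space M \<Longrightarrow> norm (\<Phi> 1 x v) \<le> \<beta> * norm v"
begin

lemma T_in_space: "x \<in> space M \<Longrightarrow> T x \<in> space M"
  using measurable_space[OF T_measurable] .

lemma \<Phi>_Suc: "\<Phi> (Suc n) x v = \<Phi> n (T x) (\<Phi> 1 x v)"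
  using \<Phi>_add[of 1 n x v] by simp

lemma \<Phi>_Suc': "\<Phi> (Suc n) x v = \<Phi> 1 ((T ^^ n) x) (\<Phi> n x v)"
  using \<Phi>_add[of n 1 x v] by simp

lemma norm_\<Phi>_le: "x \<in> space M \<Longrightarrow> norm (\<Phi> n x v) \<le> \<beta> ^ n * norm v"
proof (induction n)
  case (Suc n)
  have "norm (\<Phi> (Suc n) x v) \<le> \<beta> * norm (\<Phi> n x v)"
    unfolding \<Phi>_Suc' by (rule \<Phi>_bound[OF iter_in_space[OF Suc.prems]])
  also have "\<dots> \<le> \<beta> * (\<beta> ^ n * norm v)"
    using \<beta> Suc by (intro mult_left_mono) auto
  finally show ?case by (simp add: mult.assoc)
qed (simp add: \<Phi>_0)

lemma bounded_linear_\<Phi>: "bounded_linear (\<Phi> n x)"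
  using lin by (rule linear_conv_bounded_linear[THEN iffD1])

lemma continuous_on_\<Phi> [continuous_intros]:
  "continuous_on U f \<Longrightarrow> continuous_on U (\<lambda>y. \<Phi> n x (f y))"
  using bounded_linear.continuous_on[OF bounded_linear_\<Phi>] .

lemma \<Phi>_measurable_compose [measurable (raw)]:
  assumes [measurable]: "f \<in> borel_measurable M"
  shows "(\<lambda>x. \<Phi> n x (f x)) \<in> borel_measurable M"
proof -
  have "\<Phi> n x (f x) = (\<Sum>b\<in>Basis. inner (f x) b *\<^sub>R \<Phi> n x b)" for x
  proof -
    have "\<Phi> n x (f x) = \<Phi> n x (\<Sum>b\<in>Basis. inner (f x) b *\<^sub>R b)"
      by (simp only: euclidean_representation)
    also have "\<dots> = (\<Sum>b\<in>Basis. inner (f x) b *\<^sub>R \<Phi> n x b)"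
      by (simp only: linear_sum[OF lin] linear_scale[OF lin])
    finally show ?thesis .
  qed
  then show ?thesis by simp
qed

definition invariant_field :: "('x \<Rightarrow> 'v set) \<Rightarrow> bool" where
  "invariant_field W \<longleftrightarrow> (\<forall>x\<in>space M. \<forall>w\<in>W x. \<Phi> 1 x w \<in> W (T x))"

lemma invariant_field_iter:
  assumes "invariant_field W" "x \<in> space M" "w \<in> W x"
  shows "\<Phi> n x w \<in> W ((T ^^ n) x)"
proof (induction n)
  case (Suc n)
  then show ?case
    unfolding \<Phi>_Suc' using assms(1) iter_in_space[OF assms(2)] by (simp add: invariant_field_def)
qed (simp add: assms \<Phi>_0)

text \<open>The norm of \<open>\<Phi> n x\<close> restricted to \<open>W x\<close>. Composing with the projection makes it the norm of a map defined on
the whole space, so that a dense sequence independent of \<open>x\<close> suffices to compute it.\<close>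

definition field_norm :: "('x \<Rightarrow> 'v set) \<Rightarrow> nat \<Rightarrow> 'x \<Rightarrow> real" where
  "field_norm W n x = onorm (\<lambda>v. \<Phi> n x (orth_proj (W x) v))"

context
  fixes W :: "'x \<Rightarrow> 'v set"
  assumes W: "measurable_field M W"
begin

lemma bounded_linear_field: "bounded_linear (\<lambda>v. \<Phi> n x (orth_proj (W x) v))"
  by (intro bounded_linear_compose[OF bounded_linear_\<Phi>] linear_conv_bounded_linear[THEN iffD1]
      linear_orth_proj measurable_fieldD(1)[OF W])

lemma field_norm_nonneg: "0 \<le> field_norm W n x"
  unfolding field_norm_def by (rule onorm_pos_le[OF bounded_linear_field])

lemma norm_\<Phi>_le_field_norm:
  assumes "w \<in> W x"
  shows "norm (\<Phi> n x w) \<le> field_norm W n x * norm w"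
  using onorm[OF bounded_linear_field, of n x w] orth_proj_id[OF measurable_fieldD(1)[OF W] assms]
  by (simp add: field_norm_def)

lemma field_norm_leI:
  assumes "0 \<le> b" "\<And>w. w \<in> W x \<Longrightarrow> norm (\<Phi> n x w) \<le> b * norm w"
  shows "field_norm W n x \<le> b"
  unfolding field_norm_def
proof (rule onorm_bound[OF assms(1)])
  fix v
  have "norm (\<Phi> n x (orth_proj (W x) v)) \<le> b * norm (orth_proj (W x) v)"
    by (intro assms(2) orth_proj_in measurable_fieldD(1)[OF W])
  also have "\<dots> \<le> b * norm v"
    by (intro mult_left_mono norm_orth_proj_le measurable_fieldD(1)[OF W] assms(1))
  finally show "norm (\<Phi> n x (orth_proj (W x) v)) \<le> b * norm v" .
qed

lemma field_norm_le_power: "x \<in> space M \<Longrightarrow> field_norm W n x \<le> \<beta> ^ n"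
  using \<beta> norm_\<Phi>_le by (intro field_norm_leI) auto

lemma field_norm_add_le:
  assumes "invariant_field W" "x \<in> space M"
  shows "field_norm W (m + n) x \<le> field_norm W n ((T ^^ m) x) * field_norm W m x"
proof (rule field_norm_leI)
  fix w assume w: "w \<in> W x"
  have "norm (\<Phi> (m + n) x w) \<le> field_norm W n ((T ^^ m) x) * norm (\<Phi> m x w)"
    unfolding \<Phi>_add by (intro norm_\<Phi>_le_field_norm invariant_field_iter assms w)
  also have "\<dots> \<le> field_norm W n ((T ^^ m) x) * (field_norm W m x * norm w)"
    by (intro mult_left_mono norm_\<Phi>_le_field_norm w field_norm_nonneg)
  finally show "norm (\<Phi> (m + n) x w) \<le> field_norm W n ((T ^^ m) x) * field_norm W m x * norm w"
    by (simp add: mult.assoc)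
qed (simp add: field_norm_nonneg)

lemma field_norm_almost_attained:
  assumes "0 < field_norm W n x"
  shows "\<exists>w\<in>W x. norm w = 1 \<and> field_norm W n x / 2 < norm (\<Phi> n x w)"
proof -
  have "\<exists>w\<in>W x. field_norm W n x / 2 * norm w < norm (\<Phi> n x w)"
  proof (rule ccontr)
    assume "\<not> ?thesis"
    then have "field_norm W n x \<le> field_norm W n x / 2"
      using assms by (intro field_norm_leI) (auto simp: not_less)
    then show False using assms by simp
  qed
  then obtain w where w: "w \<in> W x" "field_norm W n x / 2 * norm w < norm (\<Phi> n x w)" by blast
  then have "norm w > 0" using linear_0[OF lin] by auto
  then show ?thesis
    using w measurable_fieldD(1)[OF W]
    by (intro bexI[of _ "w /\<^sub>R norm w"])
       (simp_all add: linear_scale[OF lin] field_simps subspace_scale)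
qed

lemma field_norm_measurable [measurable]: "field_norm W n \<in> borel_measurable M"
proof (subst borel_measurable_iff_le, intro allI)
  fix r
  obtain q :: "nat \<Rightarrow> 'v" where q: "\<And>X. open X \<and> X \<noteq> {} \<Longrightarrow> \<exists>j. q j \<in> X"
    using dense_sequence_exists by metis
  note [measurable] = measurable_fieldD(2)[OF W]
  have "field_norm W n x \<le> r \<longleftrightarrow> 0 \<le> r \<and> (\<forall>j. norm (\<Phi> n x (orth_proj (W x) (q j))) \<le> r * norm (q j))" for x
  proof (intro iffI conjI allI)
    assume le: "field_norm W n x \<le> r"
    show "0 \<le> r" using le field_norm_nonneg[of n x] by linarith
    show "norm (\<Phi> n x (orth_proj (W x) (q j))) \<le> r * norm (q j)" for j
      using onorm[OF bounded_linear_field, of n x "q j"] mult_right_mono[OF le, of "norm (q j)"]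
      by (simp add: field_norm_def)
  next
    assume r: "0 \<le> r \<and> (\<forall>j. norm (\<Phi> n x (orth_proj (W x) (q j))) \<le> r * norm (q j))"
    let ?U = "{v. r * norm v < norm (\<Phi> n x (orth_proj (W x) v))}"
    have "open ?U"
      by (intro open_Collect_less continuous_on_norm linear_continuous_on[OF bounded_linear_field]
          continuous_on_mult continuous_on_const continuous_on_id)
    moreover have "q j \<notin> ?U" for j using r by (simp add: not_less)
    ultimately have "?U = {}" using q[of ?U] by blast
    then have "norm (\<Phi> n x (orth_proj (W x) v)) \<le> r * norm v" for v
      using not_less by blast
    then show "field_norm W n x \<le> r"
      unfolding field_norm_def using r by (intro onorm_bound) auto
  qed
  then show "{x \<in> space M. field_norm W n x \<le> r} \<in> sets M"
    by (simp only:) measurable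
qed

end


section \<open>The slow field\<close>

text \<open>Functionals are represented by vectors through the inner product, and \<open>\<rho>\<close> stands for \<open>exp (- s)\<close>.\<close>

definition dominated :: "real \<Rightarrow> 'v set \<Rightarrow> 'x \<Rightarrow> 'v set" where
  "dominated \<rho> V x = {g. \<exists>C. \<forall>n. \<forall>w\<in>V. \<bar>inner g w\<bar> \<le> C * (\<rho> ^ n * norm (\<Phi> n x w))}"

definition descend :: "real \<Rightarrow> 'v set \<Rightarrow> 'x \<Rightarrow> 'v set" where
  "descend \<rho> V x = orth_comp (dominated \<rho> V x)"

lemma subspace_dominated: "subspace (dominated \<rho> V x)"
proof (rule subspaceI)
  show "0 \<in> dominated \<rho> V x"
    unfolding dominated_def by (intro CollectI exI[of _ 0]) simp
next
  fix g h assume "g \<in> dominated \<rho> V x" "h \<in> dominated \<rho> V x"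
  then obtain C D where
    C: "\<And>n w. w \<in> V \<Longrightarrow> \<bar>inner g w\<bar> \<le> C * (\<rho> ^ n * norm (\<Phi> n x w))" and
    D: "\<And>n w. w \<in> V \<Longrightarrow> \<bar>inner h w\<bar> \<le> D * (\<rho> ^ n * norm (\<Phi> n x w))"
    unfolding dominated_def by blast
  have "\<bar>inner (g + h) w\<bar> \<le> (C + D) * (\<rho> ^ n * norm (\<Phi> n x w))" if "w \<in> V" for n w
    using C[OF that, of n] D[OF that, of n] by (simp add: inner_add_left distrib_right)
  then show "g + h \<in> dominated \<rho> V x" unfolding dominated_def by blast
next
  fix c :: real and g assume "g \<in> dominated \<rho> V x"
  then obtain C where C: "\<And>n w. w \<in> V \<Longrightarrow> \<bar>inner g w\<bar> \<le> C * (\<rho> ^ n * norm (\<Phi> n x w))"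
    unfolding dominated_def by blast
  have "\<bar>inner (c *\<^sub>R g) w\<bar> \<le> (\<bar>c\<bar> * C) * (\<rho> ^ n * norm (\<Phi> n x w))" if "w \<in> V" for n w
    using mult_left_mono[OF C[OF that, of n] abs_ge_zero[of c]] by (simp add: abs_mult mult.assoc)
  then show "c *\<^sub>R g \<in> dominated \<rho> V x" unfolding dominated_def by blast
qed

lemma dominated_nat_const:
  assumes "0 < \<rho>"
  shows "dominated \<rho> V x = (\<Union>c::nat. {g. \<forall>n. \<forall>w\<in>V. \<bar>inner g w\<bar> \<le> real c * (\<rho> ^ n * norm (\<Phi> n x w))})"
proof (intro set_eqI iffI)
  fix g assume "g \<in> dominated \<rho> V x"
  then obtain C where C: "\<forall>n. \<forall>w\<in>V. \<bar>inner g w\<bar> \<le> C * (\<rho> ^ n * norm (\<Phi> n x w))"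
    unfolding dominated_def by blast
  obtain c :: nat where "C \<le> real c" using real_arch_simple by blast
  then have "C * (\<rho> ^ n * norm (\<Phi> n x w)) \<le> real c * (\<rho> ^ n * norm (\<Phi> n x w))" for n w
    using assms by (intro mult_right_mono) auto
  then have "\<forall>n. \<forall>w\<in>V. \<bar>inner g w\<bar> \<le> real c * (\<rho> ^ n * norm (\<Phi> n x w))"
    using C by (meson order_trans)
  then show "g \<in> (\<Union>c::nat. {g. \<forall>n. \<forall>w\<in>V. \<bar>inner g w\<bar> \<le> real c * (\<rho> ^ n * norm (\<Phi> n x w))})"
    by blast
qed (auto simp: dominated_def)

lemma subspace_descend: "subspace (descend \<rho> V x)"
  unfolding descend_def by (rule subspace_orth_comp)

text \<open>Vectors orthogonal to \<open>V\<close> are trivially dominated on \<open>V\<close>.\<close>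

lemma descend_subset:
  assumes V: "subspace V"
  shows "descend \<rho> V x \<subseteq> V"
proof
  fix v assume v: "v \<in> descend \<rho> V x"
  let ?r = "v - orth_proj V v"
  have perp: "inner ?r w = 0" if "w \<in> V" for w
    using orth_proj_orthogonal[OF V that] .
  then have "?r \<in> dominated \<rho> V x"
    unfolding dominated_def by (intro CollectI exI[of _ 0]) simp
  then have "inner v ?r = 0" using v by (simp add: descend_def orth_comp_def)
  moreover have "inner (orth_proj V v) ?r = 0"
    using perp[OF orth_proj_in[OF V]] by (simp only: inner_commute)
  ultimately have "inner ?r ?r = 0" by (simp only: inner_diff_left)
  then have "v = orth_proj V v" by simp
  then show "v \<in> V" using orth_proj_in[OF V, of v] by simp
qed

lemma growth_off_descend:
  assumes "w \<in> V" "w \<notin> descend \<rho> V x"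
  shows "\<exists>c>0. \<forall>n. c \<le> \<rho> ^ n * norm (\<Phi> n x w)"
proof -
  obtain g where g: "g \<in> dominated \<rho> V x" "inner w g \<noteq> 0"
    using assms(2) by (auto simp: descend_def orth_comp_def)
  then obtain C where C: "\<And>n. \<bar>inner g w\<bar> \<le> C * (\<rho> ^ n * norm (\<Phi> n x w))"
    using assms(1) unfolding dominated_def by blast
  have pos: "0 < \<bar>inner g w\<bar>" using g(2) by (simp add: inner_commute)
  then have "0 < C * norm w" using C[of 0] by (simp add: \<Phi>_0)
  then have "0 < C" by (simp add: zero_less_mult_iff)
  have "\<bar>inner g w\<bar> / C \<le> \<rho> ^ n * norm (\<Phi> n x w)" for n
    using C[of n] \<open>0 < C\<close> by (simp add: field_simps)
  then show ?thesis using pos \<open>0 < C\<close> by (intro exI[of _ "\<bar>inner g w\<bar> / C"]) simp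
qed

text \<open>A functional dominated at \<open>T x\<close> pulls back along \<open>\<Phi> 1 x\<close> to one dominated at \<open>x\<close>: the domination at time \<open>n\<close>
shifts to time \<open>n + 1\<close>, and time \<open>0\<close> is covered by the bound \<open>\<beta>\<close> on one step.\<close>

lemma invariant_field_descend:
  assumes W: "invariant_field W" and "0 < \<rho>"
  shows "invariant_field (\<lambda>x. descend \<rho> (W x) x)"
  unfolding invariant_field_def
proof (intro ballI)
  fix x w assume x: "x \<in> space M" and w: "w \<in> descend \<rho> (W x) x"
  have "inner (\<Phi> 1 x w) g = 0" if g: "g \<in> dominated \<rho> (W (T x)) (T x)" for g
  proof -
    obtain C where C: "\<And>n w. w \<in> W (T x) \<Longrightarrow> \<bar>inner g w\<bar> \<le> C * (\<rho> ^ n * norm (\<Phi> n (T x) w))"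
      using g unfolding dominated_def by blast
    let ?C = "max (norm g * \<beta>) (C / \<rho>)"
    have "\<bar>inner (adjoint (\<Phi> 1 x) g) v\<bar> \<le> ?C * (\<rho> ^ n * norm (\<Phi> n x v))" if v: "v \<in> W x" for n v
    proof (cases n)
      case 0
      have "\<bar>inner g (\<Phi> 1 x v)\<bar> \<le> norm g * norm (\<Phi> 1 x v)" by (rule Cauchy_Schwarz_ineq2)
      also have "\<dots> \<le> norm g * (\<beta> * norm v)" by (intro mult_left_mono \<Phi>_bound x) simp
      also have "\<dots> \<le> ?C * norm v"
        by (subst mult.assoc[symmetric], intro mult_right_mono) simp_all
      finally show ?thesis using 0 by (simp add: adjoint_clauses(2)[OF lin] \<Phi>_0)
    next
      case (Suc m)
      have "\<Phi> 1 x v \<in> W (T x)" using W x v by (auto simp: invariant_field_def)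
      then have "\<bar>inner g (\<Phi> 1 x v)\<bar> \<le> C * (\<rho> ^ m * norm (\<Phi> m (T x) (\<Phi> 1 x v)))" by (rule C)
      also have "\<dots> = (C / \<rho>) * (\<rho> ^ n * norm (\<Phi> n x v))"
        using \<open>0 < \<rho>\<close> unfolding Suc \<Phi>_Suc[of m x v] by simp
      also have "\<dots> \<le> ?C * (\<rho> ^ n * norm (\<Phi> n x v))"
        using \<open>0 < \<rho>\<close> by (intro mult_right_mono) simp_all
      finally show ?thesis by (simp add: adjoint_clauses(2)[OF lin])
    qed
    then have "adjoint (\<Phi> 1 x) g \<in> dominated \<rho> (W x) x" unfolding dominated_def by blast
    then have "inner w (adjoint (\<Phi> 1 x) g) = 0" using w by (simp add: descend_def orth_comp_def)
    then show ?thesis by (simp add: adjoint_clauses(1)[OF lin])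
  qed
  then show "\<Phi> 1 x w \<in> descend \<rho> (W (T x)) (T x)" by (simp add: descend_def orth_comp_def)
qed

lemma measurable_field_descend:
  assumes W: "measurable_field M W" and "0 < \<rho>"
  shows "measurable_field M (\<lambda>x. descend \<rho> (W x) x)"
proof -
  obtain q :: "nat \<Rightarrow> 'v" where q: "\<And>X. open X \<and> X \<noteq> {} \<Longrightarrow> \<exists>j. q j \<in> X"
    using dense_sequence_exists by metis
  note [measurable] = measurable_fieldD(2)[OF W]
  let ?P = "\<lambda>x. orth_proj (W x)"
  define F where "F c i x g =
    (case prod_decode i of (n, j) \<Rightarrow> \<bar>inner g (?P x (q j))\<bar> - real c * (\<rho> ^ n * norm (\<Phi> n x (?P x (q j)))))"
    for c i :: nat and x g
  have "measurable_field M (\<lambda>x. dominated \<rho> (W x) x)"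
  proof (rule measurable_field_of_inequalities[OF subspace_dominated])
    fix x
    have "(\<forall>n. \<forall>w\<in>W x. \<bar>inner g w\<bar> \<le> real c * (\<rho> ^ n * norm (\<Phi> n x w))) \<longleftrightarrow> (\<forall>i. F c i x g \<le> 0)" (is "?L \<longleftrightarrow> ?R") for g c
    proof
      assume ?L
      then show ?R
        by (auto simp: F_def split: prod.split intro: orth_proj_in[OF measurable_fieldD(1)[OF W]])
    next
      assume R: ?R
      show ?L
      proof (intro allI ballI)
        fix n w assume w: "w \<in> W x"
        let ?U = "{v. real c * (\<rho> ^ n * norm (\<Phi> n x (?P x v))) < \<bar>inner g (?P x v)\<bar>}"
        have "open ?U"
          by (intro open_Collect_less continuous_on_norm linear_continuous_on[OF bounded_linear_field[OF W]]
              continuous_on_mult continuous_on_const continuous_on_inner continuous_on_rabs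
              linear_continuous_on[OF linear_conv_bounded_linear[THEN iffD1, OF
                linear_orth_proj[OF measurable_fieldD(1)[OF W]]]])
        moreover have "q j \<notin> ?U" for j
          using R[rule_format, of "prod_encode (n, j)"] by (simp add: F_def not_less)
        ultimately have "?U = {}" using q[of ?U] by blast
        then have "w \<notin> ?U" by blast
        then show "\<bar>inner g w\<bar> \<le> real c * (\<rho> ^ n * norm (\<Phi> n x w))"
          using orth_proj_id[OF measurable_fieldD(1)[OF W] w] by (simp add: not_less)
      qed
    qed
    then show "dominated \<rho> (W x) x = (\<Union>c. {w. \<forall>i. F c i x w \<le> 0})"
      unfolding dominated_nat_const[OF \<open>0 < \<rho>\<close>] by simp
    show "continuous_on UNIV (F c i x)" for c i
      unfolding F_def by (cases "prod_decode i") (auto intro!: continuous_intros)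
  next
    show "(\<lambda>x. F c i x w) \<in> borel_measurable M" for c i w
      unfolding F_def by (cases "prod_decode i") simp
  qed
  then show ?thesis unfolding descend_def by (rule measurable_field_orth_comp)
qed

primrec ladder :: "real \<Rightarrow> nat \<Rightarrow> 'x \<Rightarrow> 'v set" where
  "ladder \<rho> 0 = (\<lambda>x. UNIV)"
| "ladder \<rho> (Suc i) = (\<lambda>x. descend \<rho> (ladder \<rho> i x) x)"

text \<open>\<open>slow_field \<rho> x\<close> is the subspace at which the descent stops: each proper step lowers the dimension.\<close>

definition slow_field :: "real \<Rightarrow> 'x \<Rightarrow> 'v set" where
  "slow_field \<rho> = ladder \<rho> DIM('v)"

lemma ladder_measurable_invariant:
  assumes "0 < \<rho>"
  shows "measurable_field M (ladder \<rho> i) \<and> invariant_field (ladder \<rho> i)"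
proof (induction i)
  case 0
  show ?case by (simp add: measurable_field_UNIV invariant_field_def)
next
  case (Suc i)
  then show ?case
    using assms by (simp add: measurable_field_descend invariant_field_descend)
qed

lemma subspace_ladder: "subspace (ladder \<rho> i x)"
  by (cases i) (simp_all add: subspace_descend)

lemma descend_slow_field: "descend \<rho> (slow_field \<rho> x) x = slow_field \<rho> x"
proof -
  have step: "ladder \<rho> (Suc i) x = ladder \<rho> i x \<or> dim (ladder \<rho> (Suc i) x) < dim (ladder \<rho> i x)" for i
  proof (cases "ladder \<rho> (Suc i) x = ladder \<rho> i x")
    case False
    have span: "span (ladder \<rho> j x) = ladder \<rho> j x" for j
      by (simp only: span_eq_iff subspace_ladder)
    have "ladder \<rho> (Suc i) x \<subset> ladder \<rho> i x"
      using descend_subset[OF subspace_ladder] False by (simp add: psubset_eq)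
    then show ?thesis by (intro disjI2 dim_psubset) (simp only: span)
  qed simp
  have "ladder \<rho> (Suc i) x = ladder \<rho> i x \<or> dim (ladder \<rho> (Suc i) x) + Suc i \<le> DIM('v)" for i
  proof (induction i)
    case 0
    show ?case using step[of 0] by (simp del: ladder.simps(2) add: Suc_le_eq)
  next
    case (Suc i)
    show ?case
    proof (cases "ladder \<rho> (Suc i) x = ladder \<rho> i x")
      case True
      then show ?thesis by simp
    next
      case False
      then show ?thesis using Suc step[of "Suc i"] by linarith
    qed
  qed
  from this[of "DIM('v)"] have "ladder \<rho> (Suc DIM('v)) x = ladder \<rho> DIM('v) x" by linarith
  then show ?thesis by (simp add: slow_field_def)
qed

lemma growth_off_slow_field:
  assumes "w \<notin> slow_field \<rho> x"
  shows "\<exists>c>0. \<forall>n. c \<le> \<rho> ^ n * norm (\<Phi> n x w)"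
proof -
  have "w \<notin> ladder \<rho> i x \<Longrightarrow> \<exists>c>0. \<forall>n. c \<le> \<rho> ^ n * norm (\<Phi> n x w)" for i
  proof (induction i)
    case (Suc i)
    then show ?case using growth_off_descend[of w "ladder \<rho> i x" \<rho> x] by auto
  qed simp
  then show ?thesis using assms unfolding slow_field_def .
qed


section \<open>Good times and the growth dichotomy\<close>

text \<open>The product \<open>\<rho> ^ (m - l) * field_norm W (m - l) ((T ^^ l) y)\<close> is the normalized norm of the part of the
orbit of \<open>y\<close> between the times \<open>l\<close> and \<open>m\<close>.\<close>

definition good_time :: "real \<Rightarrow> ('x \<Rightarrow> 'v set) \<Rightarrow> nat \<Rightarrow> 'x \<Rightarrow> bool" where
  "good_time \<rho> W m y \<longleftrightarrow> 0 < field_norm W m y \<and>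
     (\<forall>l\<le>m. \<rho> ^ (m - l) * field_norm W (m - l) ((T ^^ l) y) \<le> \<rho> ^ m * field_norm W m y)"

text \<open>If \<open>w\<close> is a nearly norming unit vector for \<open>\<Phi> m y\<close> on \<open>W y\<close> and \<open>m\<close> is good, then the functional
\<open>v \<mapsto> \<langle>\<Phi> m y w, \<Phi> m y v\<rangle>\<close>, suitably normalized, is dominated with constant \<open>1\<close> at all times \<open>l \<le> m\<close>:
factor \<open>\<Phi> m y\<close> through time \<open>l\<close> and use that the part after \<open>l\<close> has no larger normalized norm. It takes a
value of at least \<open>1 / 2\<close> at \<open>w\<close>, so a limit along good times \<open>m \<rightarrow> \<infinity>\<close> is dominated and nonzero on \<open>W y\<close>.\<close>

lemma good_times_yield_functional:
  assumes W: "measurable_field M W" "invariant_field W" and "0 < \<rho>" and y: "y \<in> space M"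
    and good: "\<And>N. \<exists>m\<ge>N. good_time \<rho> W m y"
  shows "descend \<rho> (W y) y \<noteq> W y"
proof
  assume eq: "descend \<rho> (W y) y = W y"
  note sub = measurable_fieldD(1)[OF W(1)]
  have "\<exists>g w. g \<in> cball 0 1 \<and> w \<in> cball 0 1 \<and> w \<in> W y \<and> 1 / 2 \<le> inner g w \<and>
      (\<forall>l\<le>N. \<forall>v\<in>W y. \<bar>inner g v\<bar> \<le> \<rho> ^ l * norm (\<Phi> l y v))" for N
  proof -
    obtain m where m: "m \<ge> N" "good_time \<rho> W m y" using good by blast
    let ?f = "field_norm W m y"
    have f: "0 < ?f" using m(2) by (simp add: good_time_def)
    obtain w where w: "w \<in> W y" "norm w = 1" "?f / 2 < norm (\<Phi> m y w)"
      using field_norm_almost_attained[OF W(1) f] by blast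
    let ?u = "\<Phi> m y w"
    have u: "0 < norm ?u" using w(3) f by linarith
    \<comment> \<open>Projecting to \<open>W y\<close> keeps the values on \<open>W y\<close> and makes the norm of \<open>g\<close> at most \<open>1\<close>.\<close>
    define g where "g = orth_proj (W y) (adjoint (\<Phi> m y) (?u /\<^sub>R (?f * norm ?u)))"
    have g_inner: "inner g v = inner ?u (\<Phi> m y v) / (?f * norm ?u)" if v: "v \<in> W y" for v
    proof -
      have "inner g v = inner (adjoint (\<Phi> m y) (?u /\<^sub>R (?f * norm ?u))) v"
        unfolding g_def inner_orth_proj_commute[OF sub, symmetric] orth_proj_id[OF sub v] ..
      also have "\<dots> = inner (?u /\<^sub>R (?f * norm ?u)) (\<Phi> m y v)"
        by (rule adjoint_clauses(2)[OF lin])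
      finally show ?thesis by (simp add: divide_inverse mult.commute)
    qed
    have g_le: "\<bar>inner g v\<bar> \<le> \<rho> ^ l * norm (\<Phi> l y v)" if v: "v \<in> W y" and l: "l \<le> m" for v l
    proof -
      have "\<rho> ^ (m - l) * field_norm W (m - l) ((T ^^ l) y) \<le> \<rho> ^ (m - l) * (\<rho> ^ l * ?f)"
        using m(2) l by (simp add: good_time_def flip: power_add mult.assoc)
      then have fl: "field_norm W (m - l) ((T ^^ l) y) \<le> \<rho> ^ l * ?f"
        using \<open>0 < \<rho>\<close> by (simp add: mult_le_cancel_left_pos)
      have "\<bar>inner ?u (\<Phi> m y v)\<bar> \<le> norm ?u * norm (\<Phi> m y v)" by (rule Cauchy_Schwarz_ineq2)
      then have "\<bar>inner g v\<bar> \<le> norm (\<Phi> m y v) / ?f"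
        using u f by (simp add: g_inner[OF v] abs_mult field_simps)
      also have "norm (\<Phi> m y v) \<le> field_norm W (m - l) ((T ^^ l) y) * norm (\<Phi> l y v)"
        using \<Phi>_add[of l "m - l" y v] l
        by (simp add: norm_\<Phi>_le_field_norm[OF W(1) invariant_field_iter[OF W(2) y v]])
      also have "\<dots> \<le> \<rho> ^ l * ?f * norm (\<Phi> l y v)"
        by (intro mult_right_mono fl) simp
      finally show ?thesis using f by (simp add: field_simps divide_right_mono)
    qed
    have "g \<in> W y" unfolding g_def by (rule orth_proj_in[OF sub])
    \<comment> \<open>The domination at time \<open>0\<close>, applied to \<open>g\<close> itself, bounds its norm.\<close>
    then have "\<bar>inner g g\<bar> \<le> norm g" using g_le[of g 0] by (simp add: \<Phi>_0)
    then have "norm g * norm g \<le> 1 * norm g" by (simp add: dot_square_norm power2_eq_square)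
    then have "norm g \<le> 1" by (cases "g = 0") (simp_all add: mult_le_cancel_right)
    moreover have "1 / 2 \<le> inner g w"
      using w(3) f u by (simp add: g_inner[OF w(1)] dot_square_norm power2_eq_square field_simps)
    ultimately show ?thesis using w m(1) g_le by (intro exI[of _ g] exI[of _ w]) auto
  qed
  then obtain g w where g: "\<And>N. g N \<in> cball 0 1" and w: "\<And>N. w N \<in> cball 0 1" "\<And>N. w N \<in> W y"
    and gw: "\<And>N. 1 / 2 \<le> inner (g N) (w N)"
    and le: "\<And>N l v. l \<le> N \<Longrightarrow> v \<in> W y \<Longrightarrow> \<bar>inner (g N) v\<bar> \<le> \<rho> ^ l * norm (\<Phi> l y v)"
    by metis
  define gw' where "gw' N = (g N, w N)" for N
  have "compact (cball (0::'v) 1 \<times> cball (0::'v) 1)" by (intro compact_Times compact_cball)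
  moreover have "\<forall>N. gw' N \<in> cball 0 1 \<times> cball 0 1" using g w by (simp add: gw'_def)
  ultimately have "\<exists>p\<in>cball 0 1 \<times> cball 0 1. \<exists>\<sigma>. strict_mono \<sigma> \<and> (gw' \<circ> \<sigma>) \<longlonglongrightarrow> p"
    unfolding compact_def by (elim allE[of _ gw']) (rule mp)
  then obtain p and \<sigma> :: "nat \<Rightarrow> nat" where \<sigma>: "strict_mono \<sigma>" and p: "(gw' \<circ> \<sigma>) \<longlonglongrightarrow> p"
    by blast
  have glim: "(\<lambda>N. g (\<sigma> N)) \<longlonglongrightarrow> fst p" and wlim: "(\<lambda>N. w (\<sigma> N)) \<longlonglongrightarrow> snd p"
    using tendsto_fst[OF p] tendsto_snd[OF p] by (simp_all add: comp_def gw'_def)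
  have "snd p \<in> W y"
    using closed_sequentially[OF closed_subspace[OF sub] _ wlim] w(2) by simp
  have "\<bar>inner (fst p) v\<bar> \<le> 1 * (\<rho> ^ l * norm (\<Phi> l y v))" if v: "v \<in> W y" for v l
  proof (rule LIMSEQ_le_const2)
    show "(\<lambda>N. \<bar>inner (g (\<sigma> N)) v\<bar>) \<longlonglongrightarrow> \<bar>inner (fst p) v\<bar>" by (intro tendsto_intros glim)
    have "\<bar>inner (g (\<sigma> N)) v\<bar> \<le> 1 * (\<rho> ^ l * norm (\<Phi> l y v))" if "l \<le> N" for N
      using le[OF _ v, of l "\<sigma> N"] seq_suble[OF \<sigma>, of N] that by simp
    then show "\<exists>N0. \<forall>N\<ge>N0. \<bar>inner (g (\<sigma> N)) v\<bar> \<le> 1 * (\<rho> ^ l * norm (\<Phi> l y v))" by blast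
  qed
  then have "fst p \<in> dominated \<rho> (W y) y" unfolding dominated_def by blast
  moreover have "snd p \<in> descend \<rho> (W y) y" using \<open>snd p \<in> W y\<close> eq by simp
  ultimately have "inner (snd p) (fst p) = 0" by (simp add: descend_def orth_comp_def)
  moreover have "1 / 2 \<le> inner (fst p) (snd p)"
    by (rule LIMSEQ_le_const[OF tendsto_inner[OF glim wlim]]) (use gw in auto)
  ultimately show False by (simp add: inner_commute)
qed

text \<open>A subadditive version of Riesz's leader lemma. At a good time one step of the orbit is split off, at the
price of a factor \<open>B\<close> and a visit to \<open>D\<close>. If \<open>n\<close> is not good, the norm is smaller than that of a later part of
the same orbit segment, to which the induction hypothesis applies. Segments of length at most \<open>N\<close> cost at most
\<open>B ^ N\<close>.\<close>

lemma growth_le_good_visits: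
  assumes W: "measurable_field M W" "invariant_field W" and "0 < \<rho>"
    and B: "1 \<le> B" "\<rho> * \<beta> \<le> B"
    and D: "D = {y \<in> space M. \<exists>m\<ge>N. good_time \<rho> W m y}"
    and x: "x \<in> space M"
  shows "\<rho> ^ n * field_norm W n x \<le> B powr (visits T D n x + real N)"
  using x
proof (induction n arbitrary: x rule: less_induct)
  case (less n)
  let ?f = "\<lambda>n x. \<rho> ^ n * field_norm W n x"
  have B_mono: "B powr a \<le> B powr b" if "a \<le> b" for a b
    using that B(1) by (simp add: powr_mono)
  consider "n \<le> N" | "N < n" "field_norm W n x = 0"
    | "N < n" "good_time \<rho> W n x" | "N < n" "field_norm W n x \<noteq> 0" "\<not> good_time \<rho> W n x"
    by linarith
  then show ?case
  proof cases
    case 1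
    have "?f n x \<le> \<rho> ^ n * \<beta> ^ n"
      using \<open>0 < \<rho>\<close> by (intro mult_left_mono field_norm_le_power[OF W(1) less.prems]) simp
    also have "\<dots> \<le> B ^ n"
      using B \<open>0 < \<rho>\<close> \<beta> by (simp add: power_mono flip: power_mult_distrib)
    also have "\<dots> = B powr real n" using B(1) by (simp add: powr_realpow)
    also have "\<dots> \<le> B powr (visits T D n x + real N)"
      using 1 visits_nonneg[of T D n x] by (intro B_mono) simp
    finally show ?thesis .
  next
    case 2
    then show ?thesis by simp
  next
    case 3
    have "x \<in> D" using 3 less.prems by (auto simp: D intro: less_imp_le)
    have n: "n = 1 + (n - 1)" using 3 by simp
    have "field_norm W n x \<le> field_norm W (n - 1) (T x) * field_norm W 1 x"
      using field_norm_add_le[OF W less.prems, of 1 "n - 1"] n by simp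
    also have "\<dots> \<le> field_norm W (n - 1) (T x) * \<beta>"
      using field_norm_le_power[OF W(1) less.prems, of 1]
      by (intro mult_left_mono field_norm_nonneg[OF W(1)]) simp
    finally have "?f n x \<le> \<rho> ^ n * (field_norm W (n - 1) (T x) * \<beta>)"
      using \<open>0 < \<rho>\<close> by (intro mult_left_mono) auto
    also have "\<dots> = (\<rho> * \<beta>) * ?f (n - 1) (T x)"
      by (subst n) (simp add: mult_ac)
    also have "\<dots> \<le> B * B powr (visits T D (n - 1) (T x) + real N)"
      using 3 B less.IH[of "n - 1" "T x"] T_in_space[OF less.prems] \<open>0 < \<rho>\<close> field_norm_nonneg[OF W(1)]
      by (intro mult_mono) auto
    also have "\<dots> = B powr (visits T D n x + real N)"
      using visits_add[of T D 1 "n - 1" x] n \<open>x \<in> D\<close> B(1) by (simp add: powr_add)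
    finally show ?thesis .
  next
    case 4
    then have "0 < field_norm W n x" using field_norm_nonneg[OF W(1), of n x] by linarith
    then obtain l where l: "l \<le> n" "?f n x < ?f (n - l) ((T ^^ l) x)"
      using 4 by (auto simp: good_time_def not_le)
    then have "l \<noteq> 0" by (cases "l = 0") auto
    then have "?f (n - l) ((T ^^ l) x) \<le> B powr (visits T D (n - l) ((T ^^ l) x) + real N)"
      using l(1) by (intro less.IH iter_in_space less.prems) auto
    also have "\<dots> \<le> B powr (visits T D n x + real N)"
      using visits_add[of T D l "n - l" x] l(1) visits_nonneg[of T D l x] by (intro B_mono) simp
    finally show ?thesis using l(2) by linarith
  qed
qed

text \<open>Only the zero functional is dominated on the slow field, so no point has infinitely many good times; the
sets \<open>D N\<close> of points with a good time after \<open>N\<close> decrease to the empty set and are visited with arbitrarily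
small frequency.\<close>

lemma AE_slow_field_growth:
  assumes "0 < \<rho>"
  shows "AE x in M. \<forall>\<epsilon>>0. \<exists>K. \<forall>n. \<rho> ^ n * field_norm (slow_field \<rho>) n x \<le> K * exp (\<epsilon> * real n)"
proof -
  let ?W = "slow_field \<rho>"
  have W: "measurable_field M ?W" "invariant_field ?W"
    using ladder_measurable_invariant[OF assms] by (simp_all add: slow_field_def)
  define D where "D N = {y \<in> space M. \<exists>m\<ge>N. good_time \<rho> ?W m y}" for N
  have [measurable]: "(\<lambda>y. field_norm ?W m ((T ^^ l) y)) \<in> borel_measurable M" for m l
    using measurable_compose[OF iter_measurable field_norm_measurable[OF W(1)]] .
  have [measurable]: "field_norm ?W m \<in> borel_measurable M" for m
    by (rule field_norm_measurable[OF W(1)])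
  have D_sets: "D N \<in> sets M" for N
    unfolding D_def good_time_def by measurable
  have D_dec: "decseq D"
    unfolding D_def decseq_def by (blast intro: order_trans)
  have D_empty: "(\<Inter>N. D N) = {}"
  proof (rule ccontr)
    assume "\<not> ?thesis"
    then obtain y where "\<And>N. y \<in> D N" by auto
    then have "y \<in> space M" "\<And>N. \<exists>m\<ge>N. good_time \<rho> ?W m y" by (auto simp: D_def)
    from good_times_yield_functional[OF W assms this] show False
      using descend_slow_field by blast
  qed
  define B where "B = max 1 (\<rho> * \<beta>)"
  have B: "1 \<le> B" "\<rho> * \<beta> \<le> B" by (simp_all add: B_def)
  have "AE x in M. \<forall>k::nat. \<exists>N. \<forall>n\<ge>1. visits T (D N) n x < 1 / real (Suc k) * real n"
    unfolding AE_all_countable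
    by (intro allI AE_visits_rare D_sets D_dec D_empty) simp
  then show ?thesis
    using AE_space
  proof eventually_elim
    case (elim x)
    show ?case
    proof (intro allI impI)
      fix \<epsilon> :: real assume "0 < \<epsilon>"
      \<comment> \<open>The frequency \<open>1 / (k + 1)\<close> is chosen so that \<open>ln B / (k + 1) \<le> \<epsilon>\<close>.\<close>
      obtain k :: nat where k: "ln B / \<epsilon> \<le> real k" using real_arch_simple by blast
      obtain N where N: "\<And>n. n \<ge> 1 \<Longrightarrow> visits T (D N) n x < 1 / real (Suc k) * real n"
        using elim(1) by blast
      have "ln B \<le> \<epsilon> * real (Suc k)"
        using k \<open>0 < \<epsilon>\<close> by (simp add: field_simps)
      then have lnB: "ln B * (1 / real (Suc k)) \<le> \<epsilon>" by (simp add: field_simps)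
      have "\<rho> ^ n * field_norm ?W n x \<le> B powr real N * exp (\<epsilon> * real n)" for n
      proof -
        have v: "visits T (D N) n x \<le> 1 / real (Suc k) * real n"
          using N[of n] by (cases "n = 0") auto
        have "\<rho> ^ n * field_norm ?W n x \<le> B powr (visits T (D N) n x + real N)"
          by (rule growth_le_good_visits[OF W assms B D_def elim(2)])
        also have "\<dots> = B powr real N * exp (ln B * visits T (D N) n x)"
          using B(1) by (simp add: powr_def exp_add[symmetric] algebra_simps)
        also have "\<dots> \<le> B powr real N * exp (\<epsilon> * real n)"
        proof -
          have "ln B * visits T (D N) n x \<le> ln B * (1 / real (Suc k) * real n)"
            using B(1) v by (intro mult_left_mono) auto
          also have "\<dots> \<le> \<epsilon> * real n"
            using mult_right_mono[OF lnB, of "real n"] by (simp only: mult.assoc)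
          finally show ?thesis by (intro mult_left_mono) auto
        qed
        finally show ?thesis .
      qed
      then show "\<exists>K. \<forall>n. \<rho> ^ n * field_norm ?W n x \<le> K * exp (\<epsilon> * real n)" by blast
    qed
  qed
qed

text \<open>The first alternative holds if \<open>L\<close> is not contained in the slow field for \<open>\<rho> = exp (- s)\<close>, the second if it is.\<close>

theorem AE_growth_dichotomy:
  "AE x in M. \<forall>s\<in>\<rat>. \<forall>L.
     (\<exists>w\<in>L. \<exists>c>0. \<forall>n. c * exp (s * real n) \<le> norm (\<Phi> n x w)) \<or>
     (\<forall>\<epsilon>>0. \<exists>K. \<forall>n. \<forall>w\<in>L. norm (\<Phi> n x w) \<le> K * exp ((s + \<epsilon>) * real n) * norm w)"
proof -
  have "AE x in M. \<forall>s\<in>\<rat>. \<forall>\<epsilon>>0. \<exists>K. \<forall>n.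
      exp (- s) ^ n * field_norm (slow_field (exp (- s))) n x \<le> K * exp (\<epsilon> * real n)"
    by (subst AE_ball_countable) (simp_all add: AE_slow_field_growth countable_rat)
  then show ?thesis
  proof eventually_elim
    case (elim x)
    show ?case
    proof (intro ballI allI)
      fix s :: real and L assume "s \<in> \<rat>"
      let ?\<rho> = "exp (- s)"
      have \<rho>: "?\<rho> ^ n * a * exp (s * real n) = a" for n and a :: real
      proof -
        have "?\<rho> ^ n * exp (s * real n) = 1"
          by (simp only: exp_of_nat2_mult[symmetric] exp_add[symmetric]) simp
        then show ?thesis by (simp add: mult_ac)
      qed
      show "(\<exists>w\<in>L. \<exists>c>0. \<forall>n. c * exp (s * real n) \<le> norm (\<Phi> n x w)) \<or>
        (\<forall>\<epsilon>>0. \<exists>K. \<forall>n. \<forall>w\<in>L. norm (\<Phi> n x w) \<le> K * exp ((s + \<epsilon>) * real n) * norm w)"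
      proof (cases "L \<subseteq> slow_field ?\<rho> x")
        case False
        then obtain w c where "w \<in> L" "c > 0" and c: "\<And>n. c \<le> ?\<rho> ^ n * norm (\<Phi> n x w)"
          using growth_off_slow_field by blast
        have "c * exp (s * real n) \<le> norm (\<Phi> n x w)" for n
          using mult_right_mono[OF c[of n], of "exp (s * real n)"] by (simp only: \<rho>) simp
        then show ?thesis using \<open>w \<in> L\<close> \<open>c > 0\<close> by blast
      next
        case True
        have W: "measurable_field M (slow_field ?\<rho>)"
          using ladder_measurable_invariant[of ?\<rho>] by (simp add: slow_field_def)
        have "\<exists>K. \<forall>n. \<forall>w\<in>L. norm (\<Phi> n x w) \<le> K * exp ((s + \<epsilon>) * real n) * norm w" if "\<epsilon> > 0" for \<epsilon>
        proof -
          obtain K where K: "\<And>n. ?\<rho> ^ n * field_norm (slow_field ?\<rho>) n x \<le> K * exp (\<epsilon> * real n)"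
            using elim \<open>s \<in> \<rat>\<close> \<open>\<epsilon> > 0\<close> by blast
          have "field_norm (slow_field ?\<rho>) n x \<le> K * exp ((s + \<epsilon>) * real n)" for n
            using mult_right_mono[OF K[of n], of "exp (s * real n)"]
            unfolding \<rho> by (simp add: exp_add[symmetric] algebra_simps)
          then have "norm (\<Phi> n x w) \<le> K * exp ((s + \<epsilon>) * real n) * norm w" if "w \<in> L" for n w
            using norm_\<Phi>_le_field_norm[OF W, of w x n] that True
            by (meson mult_right_mono norm_ge_zero order_trans subsetD)
          then show ?thesis by blast
        qed
        then show ?thesis by blast
      qed
    qed
  qed
qed


section \<open>Exponential decay on decaying fields\<close>

text \<open>Let \<open>D k\<close> be the set of points where the norm exceeds \<open>1 / 2\<close> at some time after \<open>k\<close>. These sets decrease to the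
empty set, so almost every orbit stays outside some \<open>D k\<close> at least half of the time. Jumping from a visit
to the complement of \<open>D k\<close> to the first visit at least \<open>k\<close> later halves the norm and skips at most \<open>k\<close> visits.\<close>

lemma AE_exponential_decay:
  assumes W: "measurable_field M W" "invariant_field W"
    and lim: "\<And>x. x \<in> space M \<Longrightarrow> (\<lambda>n. field_norm W n x) \<longlonglongrightarrow> 0"
  shows "AE x in M. \<exists>\<gamma>>0. \<exists>K. \<forall>n. field_norm W n x \<le> K * exp (- \<gamma> * real n)"
proof -
  define D where "D k = {x \<in> space M. \<exists>n\<ge>k. 1 / 2 < field_norm W n x}" for k
  have [measurable]: "field_norm W n \<in> borel_measurable M" for n
    by (rule field_norm_measurable[OF W(1)])
  have D_sets: "D k \<in> sets M" for k
    unfolding D_def by measurable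
  have D_dec: "decseq D"
    unfolding D_def decseq_def by (blast intro: order_trans)
  have D_empty: "(\<Inter>k. D k) = {}"
  proof (rule ccontr)
    assume "\<not> ?thesis"
    then obtain x where x: "\<And>k. x \<in> D k" by auto
    then have "x \<in> space M" by (auto simp: D_def)
    then have "eventually (\<lambda>n. field_norm W n x < 1 / 2) sequentially"
      by (intro order_tendstoD(2)[OF lim]) simp_all
    then obtain k where "\<And>n. n \<ge> k \<Longrightarrow> field_norm W n x < 1 / 2"
      by (auto simp: eventually_sequentially)
    then show False using x[of k] by (force simp: D_def)
  qed
  define b where "b k n x = visits T (- D k) n x" for k n x
  have bound: "field_norm W n x \<le> \<beta> ^ k * 2 powr (1 - b k n x / real k)"
    if "1 \<le> k" "x \<in> space M" "x \<notin> D k" for k n x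
    using that(2,3)
  proof (induction n arbitrary: x rule: less_induct)
    case (less n)
    have small: "field_norm W m x \<le> 1 / 2" if "m \<ge> k" for m
      using less.prems that by (force simp: D_def)
    have pow_mono: "2 powr p \<le> 2 powr q" if "p \<le> q" for p q :: real
      using that by simp
    have b_le: "b k m y \<le> real m" for m y
      unfolding b_def by (rule visits_le)
    have "1 \<le> \<beta> ^ k" using \<beta> by simp
    show ?case
    proof (cases "n < k")
      case True
      have "field_norm W n x \<le> \<beta> ^ n" by (rule field_norm_le_power[OF W(1) less.prems(1)])
      also have "\<dots> \<le> \<beta> ^ k" using \<beta> True by (intro power_increasing) auto
      also have "\<dots> \<le> \<beta> ^ k * 2 powr (1 - b k n x / real k)"
      proof -
        have "b k n x / real k \<le> 1" using b_le[of n x] True \<open>1 \<le> k\<close> by (simp add: field_simps)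
        then have "1 \<le> 2 powr (1 - b k n x / real k)" using pow_mono[of 0] by simp
        then show ?thesis using \<open>1 \<le> \<beta> ^ k\<close> mult_left_mono[of 1 _ "\<beta> ^ k"] by simp
      qed
      finally show ?thesis .
    next
      case False
      \<comment> \<open>The next visit after waiting \<open>k\<close> steps, or the end of the segment.\<close>
      define m where "m = (LEAST m. k \<le> m \<and> (m = n \<or> (T ^^ m) x \<notin> D k))"
      have m: "k \<le> m \<and> (m = n \<or> (T ^^ m) x \<notin> D k)"
        unfolding m_def by (rule LeastI[of _ n]) (use False in simp)
      have "m \<le> n" unfolding m_def by (rule Least_le) (use False in simp)
      have b_m: "b k m x \<le> real k"
      proof -
        have "(T ^^ j) x \<in> D k" if "k \<le> j" "j < m" for j
          using not_less_Least[of j "\<lambda>m. k \<le> m \<and> (m = n \<or> (T ^^ m) x \<notin> D k)"] that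
          by (simp add: m_def)
        then have "b k m x \<le> (\<Sum>j<m. if j < k then 1 else 0)"
          unfolding b_def visits_def by (intro sum_mono) (simp add: indicator_def)
        also have "\<dots> = real k"
        proof -
          have "{..<m} \<inter> {j. j < k} = {..<k}" using m by auto
          then show ?thesis by (simp add: sum.If_cases)
        qed
        finally show ?thesis .
      qed
      show ?thesis
      proof (cases "m = n")
        case True
        then have "b k n x / real k \<le> 1" using b_m \<open>1 \<le> k\<close> by (simp add: field_simps)
        then have "1 \<le> 2 powr (1 - b k n x / real k)" using pow_mono[of 0] by simp
        then have "1 * 1 \<le> \<beta> ^ k * 2 powr (1 - b k n x / real k)"
          using \<open>1 \<le> \<beta> ^ k\<close> by (intro mult_mono) auto
        then show ?thesis using small[of n] False by simp
      next
        case False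
        then have "m < n" using \<open>m \<le> n\<close> by simp
        let ?y = "(T ^^ m) x"
        have y: "?y \<in> space M" "?y \<notin> D k"
          using iter_in_space[OF less.prems(1)] m False by auto
        have IH: "field_norm W (n - m) ?y \<le> \<beta> ^ k * 2 powr (1 - b k (n - m) ?y / real k)"
          using less.IH[of "n - m" ?y] y m \<open>1 \<le> k\<close> \<open>m < n\<close> by simp
        have "field_norm W n x \<le> field_norm W (n - m) ?y * field_norm W m x"
          using field_norm_add_le[OF W less.prems(1), of m "n - m"] \<open>m < n\<close> by simp
        also have "\<dots> \<le> (\<beta> ^ k * 2 powr (1 - b k (n - m) ?y / real k)) * (1 / 2)"
          using IH small[of m] m \<beta> by (intro mult_mono field_norm_nonneg[OF W(1)]) auto
        also have "\<dots> = \<beta> ^ k * 2 powr (- b k (n - m) ?y / real k)"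
          by (simp add: powr_diff powr_minus field_simps)
        also have "\<dots> \<le> \<beta> ^ k * 2 powr (1 - b k n x / real k)"
        proof -
          have "b k n x = b k m x + b k (n - m) ?y"
            unfolding b_def using visits_add[of T "- D k" m "n - m" x] \<open>m < n\<close> by simp
          then have "- b k (n - m) ?y / real k \<le> 1 - b k n x / real k"
            using b_m \<open>1 \<le> k\<close> by (simp add: field_simps)
          then show ?thesis using \<beta> by (intro mult_left_mono pow_mono) auto
        qed
        finally show ?thesis .
      qed
    qed
  qed
  have "AE x in M. \<exists>k. \<forall>n\<ge>1. visits T (D k) n x < 1 / 2 * real n"
    by (rule AE_visits_rare[OF D_sets D_dec D_empty]) simp
  then show ?thesis
    using AE_space
  proof eventually_elim
    case (elim x)
    then obtain k where "\<And>n. n \<ge> 1 \<Longrightarrow> visits T (D k) n x < 1 / 2 * real n" by blast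
    \<comment> \<open>The bound divides by the waiting time, which therefore has to be positive.\<close>
    moreover define k' where "k' = Suc k"
    moreover have "visits T (D k') n x \<le> visits T (D k) n x" for n
      unfolding visits_def k'_def using decseq_SucD[OF D_dec, of k]
      by (intro sum_mono) (auto simp: indicator_def)
    ultimately have k': "visits T (D k') n x < 1 / 2 * real n" if "n \<ge> 1" for n
      using that by (meson order_le_less_trans)
    have "x \<notin> D k'" using k'[of 1] by (auto simp: indicator_def split: if_splits)
    define \<gamma> where "\<gamma> = ln 2 / (2 * real k')"
    have "field_norm W n x \<le> (2 * \<beta> ^ k') * exp (- \<gamma> * real n)" for n
    proof -
      have "real n / 2 \<le> b k' n x"
        using k'[of n] visits_Compl[of T "D k'" n x] by (cases "n = 0") (simp_all add: b_def)
      then have "1 - b k' n x / real k' \<le> 1 - real n / 2 / real k'"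
        by (intro diff_left_mono divide_right_mono) simp_all
      then have "2 powr (1 - b k' n x / real k') \<le> 2 powr (1 - real n / 2 / real k')"
        by simp
      also have "\<dots> = 2 * exp (- \<gamma> * real n)"
        by (simp add: powr_def \<gamma>_def left_diff_distrib exp_diff exp_minus field_simps)
      finally have "\<beta> ^ k' * 2 powr (1 - b k' n x / real k') \<le> \<beta> ^ k' * (2 * exp (- \<gamma> * real n))"
        using \<beta> by (intro mult_left_mono) auto
      moreover have "field_norm W n x \<le> \<beta> ^ k' * 2 powr (1 - b k' n x / real k')"
        using elim(2) \<open>x \<notin> D k'\<close> by (intro bound) (simp_all add: k'_def)
      ultimately show ?thesis by (simp add: mult_ac)
    qed
    moreover have "\<gamma> > 0" by (simp add: \<gamma>_def k'_def)
    ultimately show ?case by blast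
  qed
qed

text \<open>Vectors whose orbit tends to \<open>0\<close> at a speed prescribed by \<open>k\<close>, up to a constant. Prescribing the speed leaves
a single existential quantifier over constants, as measurability of the field requires.\<close>

definition uniform_decay_field :: "(nat \<Rightarrow> nat) \<Rightarrow> 'x \<Rightarrow> 'v set" where
  "uniform_decay_field k x = {w. \<exists>C. \<forall>j. \<forall>m\<ge>k j. norm (\<Phi> m x w) \<le> C / real (Suc j)}"

lemma subspace_uniform_decay_field: "subspace (uniform_decay_field k x)"
proof (rule subspaceI)
  show "0 \<in> uniform_decay_field k x"
    unfolding uniform_decay_field_def using linear_0[OF lin]
    by (intro CollectI exI[of _ 0]) simp
next
  fix u v assume "u \<in> uniform_decay_field k x" "v \<in> uniform_decay_field k x"
  then obtain C D where
    C: "\<And>j m. m \<ge> k j \<Longrightarrow> norm (\<Phi> m x u) \<le> C / real (Suc j)" and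
    D: "\<And>j m. m \<ge> k j \<Longrightarrow> norm (\<Phi> m x v) \<le> D / real (Suc j)"
    unfolding uniform_decay_field_def by blast
  have "norm (\<Phi> m x (u + v)) \<le> (C + D) / real (Suc j)" if "m \<ge> k j" for j m
    unfolding linear_add[OF lin] add_divide_distrib
    by (intro norm_triangle_mono C D that)
  then show "u + v \<in> uniform_decay_field k x" unfolding uniform_decay_field_def by blast
next
  fix c :: real and u assume "u \<in> uniform_decay_field k x"
  then obtain C where C: "\<And>j m. m \<ge> k j \<Longrightarrow> norm (\<Phi> m x u) \<le> C / real (Suc j)"
    unfolding uniform_decay_field_def by blast
  have "norm (\<Phi> m x (c *\<^sub>R u)) \<le> (\<bar>c\<bar> * C) / real (Suc j)" if "m \<ge> k j" for j m
    using mult_left_mono[OF C[OF that] abs_ge_zero[of c]] by (simp add: linear_scale[OF lin])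
  then show "c *\<^sub>R u \<in> uniform_decay_field k x" unfolding uniform_decay_field_def by blast
qed

text \<open>The time bounds \<open>k j\<close> are lower bounds only, so dropping the first step preserves them.\<close>

lemma invariant_field_uniform_decay: "invariant_field (uniform_decay_field k)"
  unfolding invariant_field_def
proof (intro ballI)
  fix x w assume "w \<in> uniform_decay_field k x"
  then obtain C where "\<And>j m. m \<ge> k j \<Longrightarrow> norm (\<Phi> m x w) \<le> C / real (Suc j)"
    unfolding uniform_decay_field_def by blast
  then have "norm (\<Phi> m (T x) (\<Phi> 1 x w)) \<le> C / real (Suc j)" if "m \<ge> k j" for j m
    unfolding \<Phi>_Suc[symmetric] using that by simp
  then show "\<Phi> 1 x w \<in> uniform_decay_field k (T x)" unfolding uniform_decay_field_def by blast
qed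

lemma measurable_field_uniform_decay: "measurable_field M (uniform_decay_field k)"
proof (rule measurable_field_of_inequalities[OF subspace_uniform_decay_field])
  let ?F = "\<lambda>c i x w. case prod_decode i of (j, m) \<Rightarrow>
    if k j \<le> m then norm (\<Phi> m x w) - real c / real (Suc j) else 0"
  show "(\<lambda>x. ?F c i x w) \<in> borel_measurable M" for c i w
    by (cases "prod_decode i") simp
  fix x
  show "continuous_on UNIV (?F c i x)" for c i
  proof (cases "prod_decode i")
    case (Pair j m)
    then show ?thesis
      by (cases "k j \<le> m") (simp_all add: continuous_on_diff continuous_on_norm continuous_on_\<Phi>)
  qed
  have "(\<forall>i. ?F c i x w \<le> 0) \<longleftrightarrow> (\<forall>j. \<forall>m\<ge>k j. norm (\<Phi> m x w) \<le> real c / real (Suc j))" (is "?L \<longleftrightarrow> ?R") for c w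
  proof
    assume L: ?L
    show ?R
    proof (intro allI impI)
      fix j m assume "m \<ge> k j"
      then show "norm (\<Phi> m x w) \<le> real c / real (Suc j)"
        using L[rule_format, of "prod_encode (j, m)"] by simp
    qed
  next
    assume ?R
    then show ?L by (auto split: prod.split)
  qed
  moreover have "uniform_decay_field k x = (\<Union>c::nat. {w. \<forall>j. \<forall>m\<ge>k j. norm (\<Phi> m x w) \<le> real c / real (Suc j)})"
  proof (intro set_eqI iffI)
    fix w assume "w \<in> uniform_decay_field k x"
    then obtain C where C: "\<And>j m. m \<ge> k j \<Longrightarrow> norm (\<Phi> m x w) \<le> C / real (Suc j)"
      unfolding uniform_decay_field_def by blast
    obtain c :: nat where "C \<le> real c" using real_arch_simple by blast
    then have "C / real (Suc j) \<le> real c / real (Suc j)" for j by (intro divide_right_mono) auto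
    with C have "\<forall>j. \<forall>m\<ge>k j. norm (\<Phi> m x w) \<le> real c / real (Suc j)" by (meson order_trans)
    then show "w \<in> (\<Union>c::nat. {w. \<forall>j. \<forall>m\<ge>k j. norm (\<Phi> m x w) \<le> real c / real (Suc j)})" by blast
  next
    fix w assume "w \<in> (\<Union>c::nat. {w. \<forall>j. \<forall>m\<ge>k j. norm (\<Phi> m x w) \<le> real c / real (Suc j)})"
    then show "w \<in> uniform_decay_field k x" unfolding uniform_decay_field_def by blast
  qed
  ultimately show "uniform_decay_field k x = (\<Union>c. {w. \<forall>i. ?F c i x w \<le> 0})" by simp
qed

lemma uniform_decay_field_norm_tendsto_0:
  "(\<lambda>n. field_norm (uniform_decay_field k) n x) \<longlonglongrightarrow> 0"
proof -
  let ?W = "uniform_decay_field k"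
  let ?P = "orth_proj (?W x)"
  have sub: "subspace (?W x)" by (rule subspace_uniform_decay_field)
  have decay: "(\<lambda>n. \<Phi> n x w) \<longlonglongrightarrow> 0" if w: "w \<in> ?W x" for w
  proof -
    obtain C where C: "\<And>j m. m \<ge> k j \<Longrightarrow> norm (\<Phi> m x w) \<le> C / real (Suc j)"
      using w unfolding uniform_decay_field_def by blast
    show ?thesis
    proof (rule LIMSEQ_I)
      fix e :: real assume "0 < e"
      obtain j :: nat where "C / e < real j" using reals_Archimedean2 by blast
      then have "C < e * real (Suc j)" using \<open>0 < e\<close> by (simp add: field_simps)
      then have "C / real (Suc j) < e" by (simp add: field_simps)
      then show "\<exists>n0. \<forall>n\<ge>n0. norm (\<Phi> n x w - 0) < e"
        using C[of j] by (metis diff_zero order_le_less_trans)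
    qed
  qed
  have "(\<lambda>n. \<Sum>b\<in>Basis. norm (\<Phi> n x (?P b))) \<longlonglongrightarrow> (\<Sum>b\<in>(Basis :: 'v set). 0)"
    by (intro tendsto_sum tendsto_norm_zero decay orth_proj_in[OF sub])
  then have lim: "(\<lambda>n. \<Sum>b\<in>Basis. norm (\<Phi> n x (?P b))) \<longlonglongrightarrow> 0" by simp
  have "field_norm ?W n x \<le> (\<Sum>b\<in>Basis. norm (\<Phi> n x (?P b)))" for n
    unfolding field_norm_def
    by (rule onorm_componentwise[OF bounded_linear_field[OF measurable_field_uniform_decay]])
  then show ?thesis
    by (intro tendsto_sandwich[OF _ _ tendsto_const lim] always_eventually allI
        field_norm_nonneg[OF measurable_field_uniform_decay])
qed

end

section \<open>Exponential growth rates of real sequences\<close>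

lemma lower_growth_bound:
  fixes a :: "nat \<Rightarrow> real"
  assumes "0 < c" and le: "\<And>n. c * exp (s * real n) \<le> a n"
  shows "ereal s \<le> liminf (\<lambda>n. ereal (1 / real n) * log_ext (a n))"
proof -
  have "(\<lambda>n. s + ln c * (1 / real n)) \<longlonglongrightarrow> s + ln c * 0"
    by (intro tendsto_intros lim_1_over_n)
  then have lim: "(\<lambda>n. ereal (s + ln c * (1 / real n))) \<longlonglongrightarrow> ereal s" by simp
  have "\<forall>\<^sub>F n in sequentially. ereal (s + ln c * (1 / real n)) \<le> ereal (1 / real n) * log_ext (a n)"
    using eventually_gt_at_top[of 0]
  proof eventually_elim
    case (elim n)
    have "0 < c * exp (s * real n)" using \<open>0 < c\<close> by simp
    then have a: "0 < a n" using le[of n] by linarith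
    have "ln (c * exp (s * real n)) \<le> ln (a n)"
      using le[of n] \<open>0 < c * exp (s * real n)\<close> a by simp
    then have "ln c + s * real n \<le> ln (a n)" using \<open>0 < c\<close> by (simp add: ln_mult)
    then have "1 / real n * (ln c + s * real n) \<le> 1 / real n * ln (a n)"
      by (intro mult_left_mono) simp_all
    moreover have "1 / real n * (ln c + s * real n) = s + ln c * (1 / real n)"
      using elim by (simp add: field_simps)
    ultimately have "s + ln c * (1 / real n) \<le> 1 / real n * ln (a n)" by simp
    then show ?case using a by (simp add: log_ext_def)
  qed
  then have "liminf (\<lambda>n. ereal (s + ln c * (1 / real n))) \<le> liminf (\<lambda>n. ereal (1 / real n) * log_ext (a n))"
    by (rule Liminf_mono)
  then show ?thesis using lim_imp_Liminf[OF sequentially_bot lim] by simp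
qed

lemma upper_growth_bound:
  fixes a :: "nat \<Rightarrow> real"
  assumes nonneg: "\<And>n. 0 \<le> a n" and le: "\<And>n. a n \<le> K * exp (t * real n)"
  shows "limsup (\<lambda>n. ereal (1 / real n) * log_ext (a n)) \<le> ereal t"
proof -
  \<comment> \<open>A bound with \<open>K \<le> 0\<close> forces all \<open>a n\<close> to vanish; enlarging \<open>K\<close> makes its logarithm meaningful.\<close>
  define K' where "K' = max K 1"
  have K': "0 < K'" by (simp add: K'_def)
  have "(\<lambda>n. t + ln K' * (1 / real n)) \<longlonglongrightarrow> t + ln K' * 0"
    by (intro tendsto_intros lim_1_over_n)
  then have lim: "(\<lambda>n. ereal (t + ln K' * (1 / real n))) \<longlonglongrightarrow> ereal t" by simp
  have "\<forall>\<^sub>F n in sequentially. ereal (1 / real n) * log_ext (a n) \<le> ereal (t + ln K' * (1 / real n))"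
    using eventually_gt_at_top[of 0]
  proof eventually_elim
    case (elim n)
    show ?case
    proof (cases "a n = 0")
      case True
      then show ?thesis using elim by (simp add: log_ext_def)
    next
      case False
      then have a: "0 < a n" using nonneg[of n] by linarith
      have "K * exp (t * real n) \<le> K' * exp (t * real n)"
        by (intro mult_right_mono) (simp_all add: K'_def)
      then have "a n \<le> K' * exp (t * real n)" using le[of n] by linarith
      then have "ln (a n) \<le> ln (K' * exp (t * real n))" using a K' by simp
      then have "ln (a n) \<le> ln K' + t * real n" using K' by (simp add: ln_mult)
      then have "1 / real n * ln (a n) \<le> t + ln K' * (1 / real n)" using elim by (simp add: field_simps)
      then show ?thesis using False by (simp add: log_ext_def)
    qed
  qed
  then have "limsup (\<lambda>n. ereal (1 / real n) * log_ext (a n)) \<le> limsup (\<lambda>n. ereal (t + ln K' * (1 / real n)))"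
    by (rule Limsup_mono)
  then show ?thesis using lim_imp_Limsup[OF sequentially_bot lim] by simp
qed

text \<open>A rational number strictly between the lower and the upper rate would contradict whichever alternative holds for it.\<close>

lemma growth_rate_exists:
  fixes a :: "nat \<Rightarrow> real"
  assumes nonneg: "\<And>n. 0 \<le> a n"
    and dich: "\<And>s. s \<in> \<rat> \<Longrightarrow> (\<exists>c>0. \<forall>n. c * exp (s * real n) \<le> a n) \<or>
                (\<forall>\<epsilon>>0. \<exists>K. \<forall>n. a n \<le> K * exp ((s + \<epsilon>) * real n))"
  shows "(\<lambda>n. ereal (1 / real n) * log_ext (a n)) \<longlonglongrightarrow> limsup (\<lambda>n. ereal (1 / real n) * log_ext (a n))"
proof -
  let ?e = "\<lambda>n. ereal (1 / real n) * log_ext (a n)"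
  have "\<not> liminf ?e < limsup ?e"
  proof
    assume "liminf ?e < limsup ?e"
    then obtain r :: rat where r: "liminf ?e < real_of_rat r" "real_of_rat r < limsup ?e"
      using ereal_dense3 by blast
    from dich[OF Rats_of_rat[of r]] show False
    proof (elim disjE exE conjE)
      fix c :: real assume "0 < c" "\<forall>n. c * exp (real_of_rat r * real n) \<le> a n"
      then have "ereal (real_of_rat r) \<le> liminf ?e" by (intro lower_growth_bound) auto
      with r(1) show False by simp
    next
      assume up: "\<forall>\<epsilon>>0. \<exists>K. \<forall>n. a n \<le> K * exp ((real_of_rat r + \<epsilon>) * real n)"
      have "limsup ?e \<le> ereal (real_of_rat r)"
      proof (rule ereal_le_epsilon2)
        fix \<epsilon> :: real assume "0 < \<epsilon>"
        then obtain K where "\<And>n. a n \<le> K * exp ((real_of_rat r + \<epsilon>) * real n)" using up by blast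
        from upper_growth_bound[of a K "real_of_rat r + \<epsilon>", OF nonneg this]
        show "limsup ?e \<le> ereal (real_of_rat r) + ereal \<epsilon>" by simp
      qed
      with r(2) show False by simp
    qed
  qed
  moreover have "liminf ?e \<le> limsup ?e" by (rule Liminf_le_Limsup) simp
  ultimately have "liminf ?e = limsup ?e" by simp
  then show ?thesis by (simp add: tendsto_iff_Liminf_eq_Limsup)
qed

section \<open>Vector norms and restricted operator norms\<close>

lemma
  assumes "vector_norm N"
  shows vector_norm_0: "N 0 = 0"
    and vector_norm_triangle: "N (x + y) \<le> N x + N y"
    and vector_norm_scale: "N (c *\<^sub>R x) = \<bar>c\<bar> * N x"
    and vector_norm_nonneg: "0 \<le> N x"
proof -
  note N = assms[unfolded vector_norm_def]
  show N0: "N 0 = 0" and tri: "N (x + y) \<le> N x + N y" for x y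
    using N by blast+
  show sc: "N (c *\<^sub>R x) = \<bar>c\<bar> * N x" for c x using N by blast
  show "0 \<le> N x" using tri[of x "- x"] sc[of "-1" x] N0 by simp
qed

lemma vector_norm_le:
  fixes N :: "'v::euclidean_space \<Rightarrow> real"
  assumes N: "vector_norm N"
  shows "N v \<le> (1 + (\<Sum>b\<in>Basis. N b)) * norm v"
proof -
  have "N (\<Sum>b\<in>B. f b) \<le> (\<Sum>b\<in>B. N (f b))" if "finite B" for f :: "'v \<Rightarrow> 'v" and B
    using that
  proof (induction B rule: finite_induct)
    case empty
    then show ?case by (simp add: vector_norm_0[OF N])
  next
    case (insert b B)
    then show ?case using vector_norm_triangle[OF N, of "f b" "\<Sum>b\<in>B. f b"] by simp
  qed
  then have "N (\<Sum>b\<in>Basis. inner v b *\<^sub>R b) \<le> (\<Sum>b\<in>Basis. N (inner v b *\<^sub>R b))" by simp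
  then have "N v \<le> (\<Sum>b\<in>Basis. N (inner v b *\<^sub>R b))" by (simp only: euclidean_representation)
  also have "\<dots> \<le> (\<Sum>b\<in>Basis. norm v * N b)"
    by (intro sum_mono) (simp add: vector_norm_scale[OF N] mult_right_mono Basis_le_norm vector_norm_nonneg[OF N])
  also have "\<dots> = (\<Sum>b\<in>Basis. N b) * norm v"
    unfolding sum_distrib_left[symmetric] by (rule mult.commute)
  also have "\<dots> \<le> (1 + (\<Sum>b\<in>Basis. N b)) * norm v"
    by (intro mult_right_mono) simp_all
  finally show ?thesis .
qed

lemma vector_norm_continuous:
  fixes N :: "'v::euclidean_space \<Rightarrow> real"
  assumes N: "vector_norm N"
  shows "continuous_on UNIV N"
proof -
  let ?C = "1 + (\<Sum>b\<in>Basis. N b)"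
  have C: "0 < ?C" using vector_norm_nonneg[OF N] by (simp add: add_pos_nonneg sum_nonneg)
  have diff: "N u - N v \<le> ?C * norm (u - v)" for u v
    using vector_norm_triangle[OF N, of v "u - v"] vector_norm_le[OF N, of "u - v"] by simp
  have "\<bar>N u - N v\<bar> \<le> ?C * norm (u - v)" for u v
    using diff[of u v] diff[of v u] by (simp add: norm_minus_commute abs_le_iff)
  then have "?C-lipschitz_on UNIV N"
    using C by (intro lipschitz_onI) (auto simp: dist_real_def dist_norm)
  then show ?thesis by (rule lipschitz_on_continuous_on)
qed

lemma vector_norm_equivalent:
  fixes N :: "'v::euclidean_space \<Rightarrow> real"
  assumes N: "vector_norm N"
  shows "\<exists>c C. 0 < c \<and> 0 < C \<and> (\<forall>v. c * norm v \<le> N v) \<and> (\<forall>v. N v \<le> C * norm v)"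
proof -
  obtain b :: 'v where "b \<in> Basis" using nonempty_Basis by blast
  then have "sphere (0::'v) 1 \<noteq> {}" by force
  then obtain u where u: "norm u = 1" and min: "\<And>v. norm v = 1 \<Longrightarrow> N u \<le> N v"
    using continuous_attains_inf[of "sphere 0 1" N] continuous_on_subset[OF vector_norm_continuous[OF N]]
    by (auto simp: dist_norm)
  have "u \<noteq> 0" using u by auto
  then have "N u \<noteq> 0" using N by (simp add: vector_norm_def)
  then have "0 < N u" using vector_norm_nonneg[OF N, of u] by simp
  moreover have "N u * norm v \<le> N v" for v
  proof (cases "v = 0")
    case False
    then have "N u \<le> N (v /\<^sub>R norm v)" by (intro min) simp
    then show ?thesis using False by (simp add: vector_norm_scale[OF N] field_simps)
  qed (simp add: vector_norm_0[OF N])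
  moreover have "0 < 1 + (\<Sum>b\<in>Basis. N b)"
    using vector_norm_nonneg[OF N] by (simp add: add_pos_nonneg sum_nonneg)
  ultimately show ?thesis using vector_norm_le[OF N] by blast
qed

text \<open>The given norm compared with the Euclidean norm; the cocycle estimates use the latter.\<close>

locale equivalent_vector_norm =
  fixes N :: "real ^ 'd \<Rightarrow> real" and c C :: real
  assumes N: "vector_norm N"
    and c_pos: "0 < c" and C_pos: "0 < C"
    and N_ge: "c * norm v \<le> N v" and N_le: "N v \<le> C * norm v"
begin

lemma N_pos: "v \<noteq> 0 \<Longrightarrow> 0 < N v"
  using N vector_norm_nonneg[OF N, of v] by (auto simp: vector_norm_def less_le)

lemma restr_onorm_le:
  assumes "0 \<in> L" "0 \<le> b" "\<And>u. u \<in> L \<Longrightarrow> N (M *v u) \<le> b * N u"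
  shows "restr_onorm N M L \<le> b"
  unfolding restr_onorm_def
proof (rule cSUP_least)
  fix u assume u: "u \<in> L"
  show "N (M *v u) / N u \<le> b"
  proof (cases "u = 0")
    case False
    then show ?thesis using N_pos[OF False] assms(3)[OF u] by (simp add: field_simps)
  qed (simp add: vector_norm_0[OF N] assms(2))
qed (use assms(1) in auto)

lemma bdd_above_quotient: "bdd_above ((\<lambda>u. N (M *v u) / N u) ` L)"
proof (rule bdd_aboveI2)
  fix u
  let ?K = "onorm ((*v) M)"
  have K: "0 \<le> ?K" by (rule onorm_pos_le[OF matrix_vector_mul_bounded_linear])
  show "N (M *v u) / N u \<le> C * ?K / c"
  proof (cases "u = 0")
    case True
    then show ?thesis using K c_pos C_pos by (simp add: vector_norm_0[OF N])
  next
    case False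
    have "N (M *v u) \<le> C * norm (M *v u)" by (rule N_le)
    also have "\<dots> \<le> C * (?K * norm u)"
      using C_pos by (intro mult_left_mono onorm[OF matrix_vector_mul_bounded_linear]) simp
    also have "\<dots> \<le> C * (?K * (N u / c))"
      using C_pos K c_pos N_ge[of u] by (intro mult_left_mono) (simp_all add: field_simps)
    finally show ?thesis using N_pos[OF False] c_pos by (simp add: field_simps)
  qed
qed

lemma restr_onorm_ge: "u \<in> L \<Longrightarrow> N (M *v u) / N u \<le> restr_onorm N M L"
  unfolding restr_onorm_def by (rule cSUP_upper[OF _ bdd_above_quotient])

lemma restr_onorm_bound:
  assumes "u \<in> L"
  shows "N (M *v u) \<le> restr_onorm N M L * N u"
proof (cases "u = 0")
  case False
  then show ?thesis using restr_onorm_ge[OF assms, of M] N_pos[OF False] by (simp add: field_simps)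
qed (simp add: vector_norm_0[OF N])

lemma restr_onorm_nonneg: "0 \<in> L \<Longrightarrow> 0 \<le> restr_onorm N M L"
  using restr_onorm_ge[of 0 L M] by (simp add: vector_norm_0[OF N])

lemma norm_le_restr_onorm:
  assumes "u \<in> L"
  shows "norm (M *v u) \<le> restr_onorm N M L * (N u / c)"
  using N_ge[of "M *v u"] restr_onorm_bound[OF assms, of M] c_pos by (simp add: field_simps)

lemma restr_onorm_le_of_norm_le:
  assumes "0 \<in> L" "\<And>u. u \<in> L \<Longrightarrow> norm (M *v u) \<le> b * norm u"
  shows "restr_onorm N M L \<le> C * \<bar>b\<bar> / c"
proof (rule restr_onorm_le[OF assms(1)])
  fix u assume u: "u \<in> L"
  have "N (M *v u) \<le> C * norm (M *v u)" by (rule N_le)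
  also have "\<dots> \<le> C * (\<bar>b\<bar> * norm u)"
  proof -
    have "b * norm u \<le> \<bar>b\<bar> * norm u" by (intro mult_right_mono) auto
    then have "norm (M *v u) \<le> \<bar>b\<bar> * norm u" using assms(2)[OF u] by linarith
    then show ?thesis using C_pos by simp
  qed
  also have "\<dots> \<le> C * (\<bar>b\<bar> * (N u / c))"
    using C_pos c_pos N_ge[of u] by (intro mult_left_mono) (simp_all add: field_simps)
  finally show "N (M *v u) \<le> C * \<bar>b\<bar> / c * N u" by simp
qed (use C_pos c_pos in simp)

lemma restr_onorm_measurable:
  fixes F :: "'x \<Rightarrow> real ^ 'd ^ 'd"
  assumes L: "subspace L" and F [measurable]: "\<And>v. (\<lambda>x. F x *v v) \<in> borel_measurable M"
  shows "(\<lambda>x. restr_onorm N (F x) L) \<in> borel_measurable M"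
proof (subst borel_measurable_iff_le, intro allI)
  fix r
  obtain q :: "nat \<Rightarrow> real ^ 'd" where q: "\<And>X. open X \<and> X \<noteq> {} \<Longrightarrow> \<exists>j. q j \<in> X"
    using dense_sequence_exists by metis
  let ?P = "orth_proj L"
  have [measurable]: "N \<in> borel_measurable borel"
    using vector_norm_continuous[OF N] by (rule borel_measurable_continuous_onI)
  have L0: "0 \<in> L" using L by (rule subspace_0)
  have "restr_onorm N (F x) L \<le> r \<longleftrightarrow> 0 \<le> r \<and> (\<forall>j. N (F x *v ?P (q j)) \<le> r * N (?P (q j)))" for x
  proof (intro iffI conjI allI)
    assume le: "restr_onorm N (F x) L \<le> r"
    show "0 \<le> r" using le restr_onorm_nonneg[OF L0, of "F x"] by linarith
    fix j
    have "N (F x *v ?P (q j)) \<le> restr_onorm N (F x) L * N (?P (q j))"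
      by (intro restr_onorm_bound orth_proj_in L)
    also have "\<dots> \<le> r * N (?P (q j))" by (intro mult_right_mono le vector_norm_nonneg N)
    finally show "N (F x *v ?P (q j)) \<le> r * N (?P (q j))" .
  next
    assume r: "0 \<le> r \<and> (\<forall>j. N (F x *v ?P (q j)) \<le> r * N (?P (q j)))"
    let ?U = "{v. r * N (?P v) < N (F x *v ?P v)}"
    have P: "continuous_on UNIV ?P"
      by (intro linear_continuous_on linear_conv_bounded_linear[THEN iffD1] linear_orth_proj L)
    have FP: "continuous_on UNIV (\<lambda>v. F x *v ?P v)"
      by (intro linear_continuous_on bounded_linear_compose[OF matrix_vector_mul_bounded_linear]
          linear_conv_bounded_linear[THEN iffD1] linear_orth_proj L)
    have "open ?U"
      by (intro open_Collect_less continuous_on_mult continuous_on_const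
          continuous_on_compose2[OF vector_norm_continuous[OF N]] P FP) auto
    moreover have "q j \<notin> ?U" for j using r by (simp add: not_less)
    ultimately have "?U = {}" using q[of ?U] by blast
    then have "N (F x *v ?P v) \<le> r * N (?P v)" for v using not_less by blast
    then have "N (F x *v u) \<le> r * N u" if "u \<in> L" for u
      using orth_proj_id[OF L that] by metis
    then show "restr_onorm N (F x) L \<le> r" using r by (intro restr_onorm_le L0) auto
  qed
  then show "{x \<in> space M. restr_onorm N (F x) L \<le> r} \<in> sets M"
    by (simp only:) measurable
qed

end

section \<open>The cocycle over the shift\<close>

definition shift :: "(nat \<Rightarrow> 's) \<Rightarrow> nat \<Rightarrow> 's" where
  "shift x = (\<lambda>i. x (Suc i))"

lemma shift_iter: "(shift ^^ n) x = (\<lambda>i. x (i + n))"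
  by (induction n) (simp_all add: shift_def)

text \<open>Stationarity determines the image measure on cylinder sets, which generate the product \<open>\<sigma>\<close>-algebra.\<close>

lemma stationary_shift:
  assumes proc: "random_process S \<mu>" and stat: "stationary S \<mu>"
  shows "measure_preserving_system \<mu> shift"
proof -
  interpret prob_space \<mu> using proc by (simp add: random_process_def)
  have sets: "sets \<mu> = sets (\<Pi>\<^sub>M i\<in>UNIV. S)" using proc by (simp add: random_process_def)
  then have space: "space \<mu> = space (\<Pi>\<^sub>M i\<in>UNIV. S)" by (rule sets_eq_imp_space_eq)
  have "shift \<in> measurable (\<Pi>\<^sub>M i\<in>UNIV. S) (\<Pi>\<^sub>M i\<in>UNIV. S)"
    unfolding shift_def[abs_def]
    by (rule measurable_PiM_single') (auto simp: space_PiM)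
  then have meas: "shift \<in> measurable \<mu> \<mu>"
    by (simp add: measurable_cong_sets[OF sets sets])
  have "distr \<mu> \<mu> shift = \<mu>"
  proof (rule measure_eqI_PiM_infinite[where I = UNIV and M = "\<lambda>_. S"])
    fix C :: "nat \<Rightarrow> 'a set" and J :: "nat set"
    assume J: "finite J" and C: "\<And>i. i \<in> J \<Longrightarrow> C i \<in> sets S"
    let ?X = "prod_emb UNIV (\<lambda>_. S) J (Pi\<^sub>E J C)"
    have X: "?X = {x \<in> space \<mu>. \<forall>i\<in>J. x i \<in> C i}"
      by (auto simp: prod_emb_def space space_PiM PiE_iff)
    have X_sets: "?X \<in> sets \<mu>"
      unfolding sets using J C by (intro sets_PiM_I) auto
    have "emeasure (distr \<mu> \<mu> shift) ?X = emeasure \<mu> (shift -` ?X \<inter> space \<mu>)"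
      by (rule emeasure_distr[OF meas X_sets])
    also have "shift -` ?X \<inter> space \<mu> = {x \<in> space \<mu>. \<forall>i\<in>J. x (i + 1) \<in> C i}"
      using measurable_space[OF meas] unfolding X by (auto simp: shift_def)
    also have "measure \<mu> \<dots> = measure \<mu> ?X"
    proof (cases "J = {}")
      case True
      then show ?thesis unfolding X by simp
    next
      case False
      then show ?thesis unfolding X using stat J C unfolding stationary_def by blast
    qed
    then have "emeasure \<mu> {x \<in> space \<mu>. \<forall>i\<in>J. x (i + 1) \<in> C i} = emeasure \<mu> ?X"
      by (simp add: emeasure_eq_measure)
    finally show "emeasure (distr \<mu> \<mu> shift) ?X = emeasure \<mu> ?X" .
  qed (simp_all add: sets finite_measure_distr meas)
  with meas show ?thesis by unfold_locales
qed

lemma matrix_vector_mult_measurable: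
  fixes F :: "'x \<Rightarrow> real ^ 'n ^ 'm"
  assumes "F \<in> borel_measurable M" "g \<in> borel_measurable M"
  shows "(\<lambda>x. F x *v g x) \<in> borel_measurable M"
proof (rule borel_measurable_continuous_Pair[OF assms])
  show "continuous_on UNIV (\<lambda>p :: (real ^ 'n ^ 'm) \<times> (real ^ 'n). fst p *v snd p)"
    unfolding matrix_vector_mult_def by (intro continuous_intros)
qed

lemma linear_system_measurable:
  assumes sets: "sets \<mu> = sets (\<Pi>\<^sub>M i\<in>UNIV. S)" and A: "A \<in> borel_measurable S"
  shows "(\<lambda>x. linear_system A n x *v v) \<in> borel_measurable \<mu>"
proof (induction n)
  case (Suc n)
  have "(\<lambda>x. x n) \<in> measurable \<mu> S"
    by (simp add: measurable_cong_sets[OF sets refl])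
  then have "(\<lambda>x. A (x n)) \<in> borel_measurable \<mu>" using A by (rule measurable_compose)
  then have "(\<lambda>x. A (x n) *v (linear_system A n x *v v)) \<in> borel_measurable \<mu>"
    using Suc by (rule matrix_vector_mult_measurable)
  then show ?case by (simp add: matrix_vector_mul_assoc)
qed simp

lemma linear_system_cocycle:
  assumes proc: "random_process S \<mu>" and stat: "stationary S \<mu>"
    and A: "A \<in> borel_measurable S"
    and bound: "\<And>s v. s \<in> space S \<Longrightarrow> norm (A s *v v) \<le> \<beta> * norm v" and "1 \<le> \<beta>"
  shows "linear_cocycle \<mu> shift (\<lambda>n x v. linear_system A n x *v v) \<beta>"
proof -
  interpret measure_preserving_system \<mu> shift using stationary_shift[OF proc stat] .
  have sets: "sets \<mu> = sets (\<Pi>\<^sub>M i\<in>UNIV. S)" using proc by (simp add: random_process_def)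
  then have space: "space \<mu> = space (\<Pi>\<^sub>M i\<in>UNIV. S)" by (rule sets_eq_imp_space_eq)
  show ?thesis
  proof
    show "linear_system A (m + n) x *v v
        = linear_system A n ((shift ^^ m) x) *v (linear_system A m x *v v)" for m n x v
      by (induction n) (simp_all add: shift_iter matrix_vector_mul_assoc[symmetric] add.commute)
    show "norm (linear_system A 1 x *v v) \<le> \<beta> * norm v" if "x \<in> space \<mu>" for x v
      using that bound[of "x 0" v] by (simp add: space space_PiM PiE_iff)
  qed (simp_all add: linear_system_measurable[OF sets A] \<open>1 \<le> \<beta>\<close> matrix_vector_right_distrib
      matrix_vector_mult_scaleR)
qed

section \<open>Lyapunov and exponential stability\<close>

theorem theorem3p5:
  fixes N :: "real ^ 'd \<Rightarrow> real"
    and S :: "'s measure"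
    and \<mu> :: "(nat \<Rightarrow> 's) measure"
    and A :: "'s \<Rightarrow> real ^ 'd ^ 'd"
    and L :: "(real ^ 'd) set"
  assumes "vector_norm N"
    and "random_process S \<mu>"
    and "stationary S \<mu>"
    and "A \<in> borel_measurable S"
    and "bounded_matrix_fun N S A"
    and "subspace L"
  shows "conditionally_Lyapunov_stable N \<mu> A L \<longleftrightarrow> conditionally_exponentially_stable N \<mu> A L"
proof -
  obtain c C where "equivalent_vector_norm N c C"
    using vector_norm_equivalent[OF assms(1)] assms(1) unfolding equivalent_vector_norm_def by blast
  then interpret N: equivalent_vector_norm N c C .
  obtain b where b: "\<And>s. s \<in> space S \<Longrightarrow> restr_onorm N (A s) UNIV \<le> b"
    using assms(5) unfolding bounded_matrix_fun_def by blast
  \<comment> \<open>The factor \<open>C / c\<close> converts an operator norm bound for \<open>N\<close> into one for the Euclidean norm.\<close>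
  define \<beta> where "\<beta> = max 1 (b * (C / c))"
  have bound: "norm (A s *v v) \<le> \<beta> * norm v" if s: "s \<in> space S" for s v
  proof -
    have "0 \<le> b" using b[OF s] N.restr_onorm_nonneg[of UNIV "A s"] by simp
    have "norm (A s *v v) \<le> restr_onorm N (A s) UNIV * (N v / c)"
      by (rule N.norm_le_restr_onorm) simp
    also have "\<dots> \<le> b * (C * norm v / c)"
      using N.c_pos \<open>0 \<le> b\<close>
      by (intro mult_mono b s divide_right_mono N.N_le) (simp_all add: vector_norm_nonneg[OF assms(1)])
    also have "\<dots> = b * (C / c) * norm v" by simp
    also have "\<dots> \<le> \<beta> * norm v" by (intro mult_right_mono) (simp_all add: \<beta>_def)
    finally show ?thesis .
  qed
  interpret linear_cocycle \<mu> shift "\<lambda>n x v. linear_system A n x *v v" \<beta>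
    by (rule linear_system_cocycle[OF assms(2-4) bound]) (simp_all add: \<beta>_def)
  have L0: "0 \<in> L" using assms(6) by (rule subspace_0)
  define a where "a n x = restr_onorm N (linear_system A n x) L" for n x
  define e where "e n x = ereal (1 / real n) * log_ext (a n x)" for n x
  have a_nonneg: "0 \<le> a n x" for n x unfolding a_def by (rule N.restr_onorm_nonneg[OF L0])
  have a_meas [measurable]: "a n \<in> borel_measurable \<mu>" for n
    unfolding a_def[abs_def] by (rule N.restr_onorm_measurable[OF assms(6) \<Phi>_measurable])
  have e_meas [measurable]: "e n \<in> borel_measurable \<mu>" for n
    unfolding e_def[abs_def] log_ext_def by measurable
  define \<Lambda> where "\<Lambda> = {x \<in> space \<mu>. (\<lambda>n. a n x) \<longlonglongrightarrow> 0}"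
  define E where "E = {x \<in> space \<mu>. \<exists>l<0. (\<lambda>n. e n x) \<longlonglongrightarrow> l}"
  have tendsto_0_iff: "(\<lambda>n. a n x) \<longlonglongrightarrow> 0 \<longleftrightarrow> (\<forall>j. \<exists>k. \<forall>n\<ge>k. a n x \<le> 1 / real (Suc j))" for x
  proof
    assume lim: "(\<lambda>n. a n x) \<longlonglongrightarrow> 0"
    show "\<forall>j. \<exists>k. \<forall>n\<ge>k. a n x \<le> 1 / real (Suc j)"
    proof
      fix j
      have "\<forall>\<^sub>F n in sequentially. a n x < 1 / real (Suc j)" by (rule order_tendstoD(2)[OF lim]) simp
      then show "\<exists>k. \<forall>n\<ge>k. a n x \<le> 1 / real (Suc j)"
        unfolding eventually_sequentially by (blast intro: less_imp_le)
    qed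
  next
    assume small: "\<forall>j. \<exists>k. \<forall>n\<ge>k. a n x \<le> 1 / real (Suc j)"
    show "(\<lambda>n. a n x) \<longlonglongrightarrow> 0"
    proof (rule LIMSEQ_I)
      fix r :: real assume "0 < r"
      then obtain j where "1 / real (Suc j) < r" using nat_approx_posE by blast
      obtain k where "\<And>n. n \<ge> k \<Longrightarrow> a n x \<le> 1 / real (Suc j)" using small by blast
      then have "norm (a n x - 0) < r" if "n \<ge> k" for n
        using that a_nonneg[of n x] \<open>1 / real (Suc j) < r\<close> by fastforce
      then show "\<exists>k. \<forall>n\<ge>k. norm (a n x - 0) < r" by blast
    qed
  qed
  have \<Lambda>_sets [measurable]: "\<Lambda> \<in> sets \<mu>"
    unfolding \<Lambda>_def tendsto_0_iff by measurable
  have E_eq: "E = {x \<in> space \<mu>. liminf (\<lambda>n. e n x) = limsup (\<lambda>n. e n x) \<and> limsup (\<lambda>n. e n x) < 0}"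
    unfolding E_def by (auto simp: tendsto_iff_Liminf_eq_Limsup)
  have E_sets [measurable]: "E \<in> sets \<mu>"
  proof -
    have meas: "(\<lambda>x. liminf (\<lambda>n. e n x)) \<in> borel_measurable \<mu>"
      "(\<lambda>x. limsup (\<lambda>n. e n x)) \<in> borel_measurable \<mu>"
      by (intro borel_measurable_liminf borel_measurable_limsup e_meas)+
    have "E = {x \<in> space \<mu>. limsup (\<lambda>n. e n x) < 0} - {x \<in> space \<mu>. liminf (\<lambda>n. e n x) < limsup (\<lambda>n. e n x)}"
      unfolding E_eq using Liminf_le_Limsup[OF sequentially_bot] by (auto simp: less_le)
    also have "\<dots> \<in> sets \<mu>"
      by (intro sets.Diff borel_measurable_less meas borel_measurable_const)
    finally show ?thesis .
  qed
  have lyap: "conditionally_Lyapunov_stable N \<mu> A L \<longleftrightarrow> 0 < prob \<Lambda>"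
    unfolding conditionally_Lyapunov_stable_def using measure_completion[OF \<Lambda>_sets]
    by (simp add: \<Lambda>_def a_def)
  have exp: "conditionally_exponentially_stable N \<mu> A L \<longleftrightarrow> 0 < prob E"
    unfolding conditionally_exponentially_stable_def using measure_completion[OF E_sets]
    by (simp add: E_def e_def a_def)
  have "E \<subseteq> \<Lambda>"
  proof
    fix x assume "x \<in> E"
    then obtain l where x: "x \<in> space \<mu>" and "l < 0" and lim: "(\<lambda>n. e n x) \<longlonglongrightarrow> l"
      by (auto simp: E_def)
    obtain t where t: "l < ereal t" "ereal t < 0" using ereal_dense2[OF \<open>l < 0\<close>] by blast
    have "\<forall>\<^sub>F n in sequentially. a n x \<le> exp (t * real n)"
      using order_tendstoD(2)[OF lim t(1)] eventually_gt_at_top[of 0]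
    proof eventually_elim
      case (elim n)
      show ?case
      proof (cases "a n x = 0")
        case False
        then have "ln (a n x) < t * real n" using elim by (simp add: e_def log_ext_def field_simps)
        then have "exp (ln (a n x)) \<le> exp (t * real n)" by simp
        then show ?thesis using False a_nonneg[of n x] by simp
      qed simp
    qed
    moreover have "(\<lambda>n. exp (t * real n)) \<longlonglongrightarrow> 0"
    proof -
      have "(\<lambda>n. exp t ^ n) \<longlonglongrightarrow> 0" using t(2) by (intro LIMSEQ_realpow_zero) auto
      then show ?thesis by (simp add: exp_of_nat2_mult)
    qed
    ultimately have "(\<lambda>n. a n x) \<longlonglongrightarrow> 0"
      by (rule tendsto_sandwich[OF always_eventually[OF allI[OF a_nonneg]] _ tendsto_const])
    then show "x \<in> \<Lambda>" using x by (simp add: \<Lambda>_def)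
  qed
  then have E_le: "prob E \<le> prob \<Lambda>" by (intro finite_measure_mono) auto
  have "0 < prob E" if pos: "0 < prob \<Lambda>"
  proof -
    \<comment> \<open>Egorov's argument: times \<open>k j\<close> are chosen such that removing the sets \<open>B j (k j)\<close> from \<open>\<Lambda>\<close> loses at most half of its measure.\<close>
    define B where "B j k = {x \<in> \<Lambda>. \<exists>m\<ge>k. 1 / real (Suc j) < a m x}" for j k
    have \<Lambda>_space: "\<Lambda> \<subseteq> space \<mu>" by (auto simp: \<Lambda>_def)
    have B_sets [measurable]: "B j k \<in> sets \<mu>" for j k
    proof -
      have "B j k = \<Lambda> \<inter> {x \<in> space \<mu>. \<exists>m\<ge>k. 1 / real (Suc j) < a m x}"
        using \<Lambda>_space by (auto simp: B_def)
      also have "\<dots> \<in> sets \<mu>" by measurable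
      finally show ?thesis .
    qed
    have "\<exists>k. prob (B j k) < prob \<Lambda> / 2 * (1 / 2) ^ Suc j" for j
    proof -
      have "decseq (B j)" unfolding decseq_def B_def by (blast intro: order_trans)
      moreover have "(\<Inter>k. B j k) = {}"
        by (auto simp: B_def \<Lambda>_def tendsto_0_iff) (meson not_less)
      ultimately have "(\<lambda>k. prob (B j k)) \<longlonglongrightarrow> 0"
        using finite_Lim_measure_decseq[of "B j"] by (simp add: image_subset_iff)
      then have "\<forall>\<^sub>F k in sequentially. prob (B j k) < prob \<Lambda> / 2 * (1 / 2) ^ Suc j"
        by (rule order_tendstoD) (use pos in simp)
      then show ?thesis by (auto simp: eventually_sequentially)
    qed
    then obtain k where k: "\<And>j. prob (B j (k j)) < prob \<Lambda> / 2 * (1 / 2) ^ Suc j" by metis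
    define \<Lambda>' where "\<Lambda>' = \<Lambda> - (\<Union>j. B j (k j))"
    have \<Lambda>'_sets: "\<Lambda>' \<in> sets \<mu>" unfolding \<Lambda>'_def by measurable
    have sums: "(\<lambda>j. prob \<Lambda> / 2 * (1 / 2) ^ Suc j) sums (prob \<Lambda> / 2 * 1)"
      by (intro sums_mult power_half_series)
    have summ: "summable (\<lambda>j. prob (B j (k j)))"
      by (rule summable_comparison_test[OF _ sums_summable[OF sums]])
         (use k in \<open>auto intro!: exI[of _ 0] less_imp_le\<close>)
    have "prob (\<Union>j. B j (k j)) \<le> (\<Sum>j. prob (B j (k j)))"
      using summ by (intro finite_measure_subadditive_countably) auto
    also have "\<dots> \<le> (\<Sum>j. prob \<Lambda> / 2 * (1 / 2) ^ Suc j)"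
      using k by (intro suminf_le summ sums_summable[OF sums]) (auto intro: less_imp_le)
    also have "\<dots> = prob \<Lambda> / 2" using sums_unique[OF sums] by simp
    finally have "prob (\<Union>j. B j (k j)) \<le> prob \<Lambda> / 2" .
    moreover have "prob \<Lambda>' = prob \<Lambda> - prob (\<Union>j. B j (k j))"
      unfolding \<Lambda>'_def by (rule finite_measure_Diff) (auto simp: B_def)
    ultimately have \<Lambda>'_pos: "0 < prob \<Lambda>'" using pos by linarith
    let ?V = "uniform_decay_field k"
    have V: "measurable_field \<mu> ?V" "invariant_field ?V"
      by (rule measurable_field_uniform_decay invariant_field_uniform_decay)+
    have L_V: "L \<subseteq> ?V x" if x: "x \<in> \<Lambda>'" for x
    proof
      fix w assume w: "w \<in> L"
      have "norm (linear_system A m x *v w) \<le> (N w / c) / real (Suc j)" if "m \<ge> k j" for j m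
      proof -
        have "a m x \<le> 1 / real (Suc j)" using x that by (auto simp: \<Lambda>'_def B_def not_less)
        then have "a m x * (N w / c) \<le> 1 / real (Suc j) * (N w / c)"
          using N.c_pos vector_norm_nonneg[OF assms(1)] by (intro mult_right_mono) simp_all
        moreover have "norm (linear_system A m x *v w) \<le> a m x * (N w / c)"
          unfolding a_def by (rule N.norm_le_restr_onorm[OF w])
        moreover have "1 / real (Suc j) * (N w / c) = (N w / c) / real (Suc j)" by simp
        ultimately show ?thesis by linarith
      qed
      then show "w \<in> ?V x" unfolding uniform_decay_field_def by blast
    qed
    have "AE x in \<mu>. x \<in> \<Lambda>' \<longrightarrow> x \<in> E"
      using AE_growth_dichotomy AE_exponential_decay[OF V uniform_decay_field_norm_tendsto_0] AE_space
    proof eventually_elim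
      case (elim x)
      show ?case
      proof
        assume x: "x \<in> \<Lambda>'"
        have upper: "\<exists>K'. \<forall>n. a n x \<le> K' * exp (t * real n)"
          if up: "\<And>n w. w \<in> L \<Longrightarrow> norm (linear_system A n x *v w) \<le> K * exp (t * real n) * norm w" for K t
        proof (intro exI allI)
          fix n
          have "a n x \<le> C * \<bar>K * exp (t * real n)\<bar> / c"
            unfolding a_def by (rule N.restr_onorm_le_of_norm_le[OF L0 up])
          then show "a n x \<le> (C * \<bar>K\<bar> / c) * exp (t * real n)" by (simp add: abs_mult mult_ac)
        qed
        have "(\<lambda>n. e n x) \<longlonglongrightarrow> limsup (\<lambda>n. e n x)"
          unfolding e_def
        proof (rule growth_rate_exists[OF a_nonneg])
          fix s :: real assume "s \<in> \<rat>"
          with elim(1) have "(\<exists>w\<in>L. \<exists>c>0. \<forall>n. c * exp (s * real n) \<le> norm (linear_system A n x *v w)) \<or>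
             (\<forall>\<epsilon>>0. \<exists>K. \<forall>n. \<forall>w\<in>L. norm (linear_system A n x *v w) \<le> K * exp ((s + \<epsilon>) * real n) * norm w)"
            by blast
          then show "(\<exists>c>0. \<forall>n. c * exp (s * real n) \<le> a n x) \<or>
            (\<forall>\<epsilon>>0. \<exists>K. \<forall>n. a n x \<le> K * exp ((s + \<epsilon>) * real n))"
          proof
            assume "\<exists>w\<in>L. \<exists>c>0. \<forall>n. c * exp (s * real n) \<le> norm (linear_system A n x *v w)"
            then obtain w d where w: "w \<in> L" and d: "0 < d"
              "\<And>n. d * exp (s * real n) \<le> norm (linear_system A n x *v w)" by blast
            have "w \<noteq> 0" using d(1) d(2)[of 0] by auto
            have "c * d / N w * exp (s * real n) \<le> a n x" for n
            proof -
              have "c * (d * exp (s * real n)) \<le> c * norm (linear_system A n x *v w)"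
                using N.c_pos d(2) by simp
              also have "\<dots> \<le> N (linear_system A n x *v w)" by (rule N.N_ge)
              also have "\<dots> \<le> a n x * N w" unfolding a_def by (rule N.restr_onorm_bound[OF w])
              finally show ?thesis using N.N_pos[OF \<open>w \<noteq> 0\<close>] by (simp add: field_simps)
            qed
            moreover have "0 < c * d / N w" using N.c_pos d(1) N.N_pos[OF \<open>w \<noteq> 0\<close>] by simp
            ultimately show ?thesis by blast
          next
            assume "\<forall>\<epsilon>>0. \<exists>K. \<forall>n. \<forall>w\<in>L. norm (linear_system A n x *v w) \<le> K * exp ((s + \<epsilon>) * real n) * norm w"
            then show ?thesis using upper by meson
          qed
        qed
        \<comment> \<open>The rate is negative because \<open>L\<close> lies in the uniformly decaying field.\<close>
        moreover have "limsup (\<lambda>n. e n x) < 0"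
        proof -
          obtain \<gamma> K where "\<gamma> > 0" and K: "\<And>n. field_norm ?V n x \<le> K * exp (- \<gamma> * real n)"
            using elim(2) by blast
          have "norm (linear_system A n x *v w) \<le> K * exp (- \<gamma> * real n) * norm w" if "w \<in> L" for n w
            using norm_\<Phi>_le_field_norm[OF V(1), of w x n] L_V[OF x] that K[of n]
            by (meson mult_right_mono norm_ge_zero order_trans subsetD)
          from upper[OF this] obtain K' where "\<And>n. a n x \<le> K' * exp (- \<gamma> * real n)" by blast
          then have "limsup (\<lambda>n. e n x) \<le> ereal (- \<gamma>)"
            unfolding e_def by (intro upper_growth_bound a_nonneg)
          also have "\<dots> < 0" using \<open>\<gamma> > 0\<close> by simp
          finally show ?thesis .
        qed
        ultimately show "x \<in> E" using elim(3) by (auto simp: E_def)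
      qed
    qed
    then have "prob \<Lambda>' \<le> prob E" using E_sets by (rule finite_measure_mono_AE)
    then show ?thesis using \<Lambda>'_pos by linarith
  qed
  then show ?thesis unfolding lyap exp using E_le by linarith
qed

end
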